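(* Let $n>m\ge 1$ and $s\ge 1$ be integers and let $A\in\mathbb Z^{m\times n}$ be a matrix such that (i) the greatest common divisor of all $m\times m$ minors of $A$ is $1$, and (ii) $\{\boldsymbol x\in\mathbb R^n_{\ge 0}:A\boldsymbol x=\boldsymbol 0\}=\{\boldsymbol 0\}$. Let $m(A)$ and $M(A)$ denote the minimum and the maximum, respectively, of the absolute values of the $m\times m$ minors of $A$. Then $$\mathrm g_s(A)\ \ge\ \frac{1}{n-m+1}\left(s^{\frac1{n-m}}\left(\sqrt{\det(AA^\intercal)}\right)^{\frac1{n-m}}\left(\frac{m(A)}{M(A)}\right)^2\sqrt{\frac{n-m}{n}}-(n-m)-2\,\frac{m(A)}{M(A)}\right).$$
   Context: For $\boldsymbol b\in\mathbb Z^m$ let $P(A,\boldsymbol b)=\{\boldsymbol x\in\mathbb R^n_{\ge 0}:A\boldsymbol x=\boldsymbol b\}$, and let $\mathcal F_s(A)=\{\boldsymbol b\in\mathbb Z^m:\#(P(A,\boldsymbol b)\cap\mathbb Z^n)\ge s\}$. Let $C\subset\mathbb R^m$ be the convex cone generated by the columns of $A$ and $\boldsymbol v=A\boldsymbol 1$, where $\boldsymbol 1\in\mathbb Z^n$ is the all-ones vector. The diagonal $s$-Frobenius number of $A$ is $$\mathrm g_s(A)=\min\{t\in\mathbb R_{\ge 0}:\ \mathrm{int}(t\boldsymbol v+C)\cap\mathbb Z^m\subseteq\mathcal F_s(A)\}.$$ *)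

theory Defs
  imports "HOL-Analysis.Analysis"
begin

definition real_mat :: "int ^ 'n ^ 'm \<Rightarrow> real ^ 'n ^ 'm" where
  "real_mat A = (\<chi> i j. real_of_int (A $ i $ j))"

definition int_vecs :: "(real ^ 'n) set" where
  "int_vecs = {x. \<forall>i. x $ i \<in> \<int>}"

text \<open>The columns are selected by an injection into the column index type, which carries no order.
  Each maximal minor therefore occurs with both signs when \<open>CARD('m) \<ge> 2\<close>; the gcd and the
  absolute values of the minors do not depend on the signs.\<close>

definition maximal_minors :: "int ^ 'n ^ 'm \<Rightarrow> int set" where
  "maximal_minors A = {det (\<chi> i j. A $ i $ (f j)) | f :: 'm \<Rightarrow> 'n. inj f}"

definition min_abs_minor :: "int ^ 'n ^ 'm \<Rightarrow> int" where
  "min_abs_minor A = Min (abs ` maximal_minors A)"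

definition max_abs_minor :: "int ^ 'n ^ 'm \<Rightarrow> int" where
  "max_abs_minor A = Max (abs ` maximal_minors A)"

definition solution_polyhedron :: "int ^ 'n ^ 'm \<Rightarrow> real ^ 'm \<Rightarrow> (real ^ 'n) set" where
  "solution_polyhedron A b = {x. (\<forall>j. 0 \<le> x $ j) \<and> real_mat A *v x = b}"

text \<open>The first disjunct is needed because \<open>card\<close> is \<open>0\<close> on infinite sets.\<close>

definition s_feasible :: "nat \<Rightarrow> int ^ 'n ^ 'm \<Rightarrow> (real ^ 'm) set" where
  "s_feasible s A = {b \<in> int_vecs.
     infinite (solution_polyhedron A b \<inter> int_vecs) \<or>
     s \<le> card (solution_polyhedron A b \<inter> int_vecs)}"

definition column_cone :: "int ^ 'n ^ 'm \<Rightarrow> (real ^ 'm) set" where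
  "column_cone A = convex_cone hull (columns (real_mat A))"

definition diagonal_vector :: "int ^ 'n ^ 'm \<Rightarrow> real ^ 'm" where
  "diagonal_vector A = real_mat A *v 1"

definition diagonal_frobenius :: "nat \<Rightarrow> int ^ 'n ^ 'm \<Rightarrow> real" where
  "diagonal_frobenius s A = (LEAST t. 0 \<le> t \<and>
     interior ((+) (t *\<^sub>R diagonal_vector A) ` column_cone A) \<inter> int_vecs \<subseteq> s_feasible s A)"

end

theory Submission
  imports Defs
begin

text \<open>
  If some maximal minor vanishes, the bound is negative.  Otherwise let \<open>J\<close> be the set of the
  \<open>m - 1\<close> columns on a facet of the cone \<open>C\<close>; the facet functional takes on the remaining
  \<open>d + 1\<close> columns values \<open>c\<^sub>k\<close> which are absolute values of maximal minors (\<open>d = n - m\<close>).  Adjoin one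
  more column \<open>j\<close> to \<open>J\<close> and call the resulting square matrix \<open>T\<close>.  Each of the \<open>\<bar>det T\<bar> = c\<^sub>j\<close>
  residue classes modulo \<open>T \<int>\<^sup>m\<close> contains a right-hand side \<open>b\<close> in the interior of \<open>t v + C\<close> on which
  the functional is at most \<open>t \<Sum>c + c\<^sub>j\<close>.  If \<open>t\<close> is admissible, each of them has \<open>s\<close> solutions,
  and all these solutions are distinguished by their \<open>d\<close> coordinates outside \<open>J \<union> {j}\<close>, which lie in a
  simplex.  Counting the lattice points of that simplex gives
  \<open>s d! \<Prod>c \<le> ((t + 1) \<Sum>c)\<^sup>d\<close>, and the Cauchy-Binet bound \<open>d! det (A A\<^sup>T) \<le> n\<^sup>d M(A)\<^sup>2\<close>
  turns this into the theorem.
\<close>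

subsection \<open>Lattice points in a simplex\<close>

lemma bernoulli_power_step:
  fixes u c :: real
  assumes "0 \<le> u" "0 \<le> c"
  shows "u ^ Suc d + real (Suc d) * c * u ^ d \<le> (u + c) ^ Suc d"
proof (induction d)
  case (Suc d)
  have "u ^ Suc (Suc d) + real (Suc (Suc d)) * c * u ^ Suc d
      \<le> (u + c) * (u ^ Suc d + real (Suc d) * c * u ^ d)"
    using assms by (simp add: algebra_simps)
  also have "\<dots> \<le> (u + c) * (u + c) ^ Suc d"
    using Suc assms by (intro mult_left_mono) auto
  finally show ?case by simp
qed simp

text \<open>Discrete form of integrating a \<open>d\<close>-th power:
  \<open>bernoulli_power_step\<close> bounds each summand by a difference of consecutive
  \<open>Suc d\<close>-th powers, and these differences telescope.\<close>

lemma sum_arith_progression_power_le: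
  fixes c H S :: real
  assumes "0 < c" "0 \<le> S" "c * real N \<le> H"
  shows "real (Suc d) * c * (\<Sum>x\<le>N. (H - c * real x + S) ^ d) \<le> (H + S + c) ^ Suc d"
proof -
  \<comment> \<open>The shift by \<open>c\<close> makes \<open>u (Suc x)\<close> the base of the
    \<open>x\<close>-th summand; \<open>c * real N \<le> H\<close> keeps it nonnegative up to
    \<open>x = N\<close>.\<close>
  define u where "u x = H + S + c - c * real x" for x :: nat
  have step: "real (Suc d) * c * (H - c * real x + S) ^ d \<le> u x ^ Suc d - u (Suc x) ^ Suc d"
    if "x \<le> N" for x
  proof -
    have "c * real x \<le> c * real N" using that assms by simp
    then have "c * real x \<le> H + S" using assms by linarith
    then have "0 \<le> u (Suc x)" by (simp add: u_def algebra_simps)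
    from bernoulli_power_step[OF this, of c d] show ?thesis
      using assms by (simp add: u_def algebra_simps)
  qed
  have "real (Suc d) * c * (\<Sum>x\<le>N. (H - c * real x + S) ^ d)
      \<le> (\<Sum>x\<le>N. u x ^ Suc d - u (Suc x) ^ Suc d)"
    unfolding sum_distrib_left by (intro sum_mono step) auto
  also have "\<dots> = u 0 ^ Suc d - u (Suc N) ^ Suc d"
    by (rule sum_telescope)
  also have "\<dots> \<le> u 0 ^ Suc d"
  proof -
    have "0 \<le> u (Suc N)" using assms by (simp add: u_def algebra_simps)
    then show ?thesis by (simp del: power_Suc)
  qed
  finally show ?thesis by (simp add: u_def)
qed

text \<open>In terms of volume: the unit cubes with lower corners at the counted points are disjoint
  and lie in the simplex enlarged to \<open>H + (\<Sum>i\<in>I. c i)\<close>. The proof replaces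
  volumes by induction on \<open>I\<close>, slicing along one coordinate.\<close>

lemma card_nat_points_weighted_simplex:
  fixes c :: "'a \<Rightarrow> real"
  assumes "finite I" "\<And>i. i \<in> I \<Longrightarrow> 0 < c i" "0 \<le> H"
  shows "finite {g \<in> I \<rightarrow>\<^sub>E (UNIV :: nat set). (\<Sum>i\<in>I. c i * real (g i)) \<le> H} \<and>
    real (card {g \<in> I \<rightarrow>\<^sub>E (UNIV :: nat set). (\<Sum>i\<in>I. c i * real (g i)) \<le> H}) *
      (fact (card I) * (\<Prod>i\<in>I. c i)) \<le> (H + (\<Sum>i\<in>I. c i)) ^ card I"
  using assms
proof (induction I arbitrary: H rule: finite_induct)
  case empty
  then show ?case by simp
next
  case (insert k I)
  define S where "S H = {g \<in> I \<rightarrow>\<^sub>E (UNIV :: nat set). (\<Sum>i\<in>I. c i * real (g i)) \<le> H}" for H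
  define S' where "S' = {g \<in> insert k I \<rightarrow>\<^sub>E (UNIV :: nat set). (\<Sum>i\<in>insert k I. c i * real (g i)) \<le> H}"
  define N where "N = nat \<lfloor>H / c k\<rfloor>"
  have ck: "0 < c k" and cI: "\<And>i. i \<in> I \<Longrightarrow> 0 < c i" using insert.prems by auto
  have N: "x \<le> N \<longleftrightarrow> c k * real x \<le> H" for x :: nat
  proof -
    have "x \<le> N \<longleftrightarrow> int x \<le> \<lfloor>H / c k\<rfloor>"
      unfolding N_def using insert.prems(2) ck by (simp add: nat_le_eq_zle le_nat_iff)
    also have "\<dots> \<longleftrightarrow> real x \<le> H / c k" by (simp add: le_floor_iff)
    also have "\<dots> \<longleftrightarrow> c k * real x \<le> H" using ck by (simp add: field_simps)
    finally show ?thesis .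
  qed
  have IH: "finite (S (H - c k * real x)) \<and> real (card (S (H - c k * real x))) *
      (fact (card I) * (\<Prod>i\<in>I. c i)) \<le> (H - c k * real x + (\<Sum>i\<in>I. c i)) ^ card I"
    if "x \<le> N" for x
    unfolding S_def using insert.IH[of "H - c k * real x"] cI that N by auto
  have sub: "S' \<subseteq> (\<Union>x\<in>{..N}. (\<lambda>g. g(k := x)) ` S (H - c k * real x))"
  proof
    fix g assume g: "g \<in> S'"
    have sum_eq: "(\<Sum>i\<in>insert k I. c i * real (g i)) = c k * real (g k) + (\<Sum>i\<in>I. c i * real (g i))"
      using insert.hyps by simp
    have "0 \<le> (\<Sum>i\<in>I. c i * real (g i))"
      using cI by (intro sum_nonneg) (simp add: less_imp_le)
    then have le: "g k \<le> N" using g sum_eq by (auto simp: S'_def N)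
    \<comment> \<open>Members of a \<open>PiE\<close> set are \<open>undefined\<close> off their
      domain, so this value turns \<open>g\<close> into a point over \<open>I\<close>.\<close>
    define g' where "g' = g(k := undefined)"
    have "(\<Sum>i\<in>I. c i * real (g' i)) = (\<Sum>i\<in>I. c i * real (g i))"
      using insert.hyps by (intro sum.cong) (auto simp: g'_def)
    moreover have "g' \<in> I \<rightarrow>\<^sub>E UNIV"
      using g insert.hyps by (auto simp: S'_def g'_def PiE_iff extensional_def)
    ultimately have "g' \<in> S (H - c k * real (g k))"
      using g sum_eq by (auto simp: S_def S'_def)
    moreover have "g = g'(k := g k)" by (simp add: g'_def)
    ultimately show "g \<in> (\<Union>x\<in>{..N}. (\<lambda>g. g(k := x)) ` S (H - c k * real x))"
      using le by blast
  qed
  have fin: "finite (\<Union>x\<in>{..N}. (\<lambda>g. g(k := x)) ` S (H - c k * real x))"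
    using IH by auto
  have "card S' \<le> (\<Sum>x\<le>N. card ((\<lambda>g. g(k := x)) ` S (H - c k * real x)))"
    by (rule order_trans[OF card_mono[OF fin sub] card_UN_le]) simp
  also have "\<dots> \<le> (\<Sum>x\<le>N. card (S (H - c k * real x)))"
    using IH by (intro sum_mono card_image_le) auto
  finally have "real (card S') \<le> (\<Sum>x\<le>N. real (card (S (H - c k * real x))))"
    by (metis of_nat_le_iff of_nat_sum)
  then have "real (card S') * (fact (card I) * (\<Prod>i\<in>I. c i))
      \<le> (\<Sum>x\<le>N. real (card (S (H - c k * real x)))) * (fact (card I) * (\<Prod>i\<in>I. c i))"
    using cI by (intro mult_right_mono mult_nonneg_nonneg prod_nonneg) (auto simp: less_imp_le)
  also have "\<dots> \<le> (\<Sum>x\<le>N. (H - c k * real x + (\<Sum>i\<in>I. c i)) ^ card I)"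
    unfolding sum_distrib_right using IH by (intro sum_mono) auto
  \<comment> \<open>The new factor turns the factorial and the product for \<open>I\<close> into
    those for \<open>insert k I\<close>.\<close>
  finally have "real (Suc (card I)) * c k * (real (card S') * (fact (card I) * (\<Prod>i\<in>I. c i)))
      \<le> real (Suc (card I)) * c k * (\<Sum>x\<le>N. (H - c k * real x + (\<Sum>i\<in>I. c i)) ^ card I)"
    using ck by (intro mult_left_mono) auto
  also have "\<dots> \<le> (H + (\<Sum>i\<in>I. c i) + c k) ^ Suc (card I)"
    using ck cI N[of N] by (intro sum_arith_progression_power_le sum_nonneg) (auto simp: less_imp_le)
  finally have "real (card S') * (fact (card (insert k I)) * (\<Prod>i\<in>insert k I. c i))
      \<le> (H + (\<Sum>i\<in>insert k I. c i)) ^ card (insert k I)"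
    using insert.hyps by (simp add: algebra_simps)
  moreover have "finite S'" using finite_subset[OF sub fin] .
  ultimately show ?case unfolding S'_def by blast
qed

subsection \<open>Integer matrices and the index of a sublattice\<close>

definition real_vec :: "int ^ 'n \<Rightarrow> real ^ 'n" where
  "real_vec x = (\<chi> i. real_of_int (x $ i))"

lemma real_vec_nth [simp]: "real_vec x $ i = real_of_int (x $ i)"
  by (simp add: real_vec_def)

lemma real_vec_inject [simp]: "real_vec x = real_vec y \<longleftrightarrow> x = y"
  by (simp add: vec_eq_iff)

lemma real_vec_in_int_vecs [simp]: "real_vec x \<in> int_vecs"
  by (simp add: int_vecs_def)

lemma int_vecsE:
  assumes "b \<in> int_vecs"
  obtains z where "b = real_vec z"
proof
  show "b = real_vec (\<chi> i. \<lfloor>b $ i\<rfloor>)"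
    using assms by (simp add: int_vecs_def vec_eq_iff)
qed

lemma real_mat_nth [simp]: "real_mat A $ i $ j = real_of_int (A $ i $ j)"
  by (simp add: real_mat_def)

lemma real_mat_mult_real_vec: "real_mat A *v real_vec x = real_vec (A *v x)"
  by (simp add: vec_eq_iff matrix_vector_mult_def)

lemma det_real_mat: "det (real_mat A) = real_of_int (det A)"
  by (simp add: det_def)

text \<open>The vector \<open>w\<close> is the adjugate of \<open>T\<close> applied to
  \<open>b\<close>; its entries are Cramer determinants, hence integers.\<close>

lemma cramer_int:
  fixes T :: "int ^ 'm ^ 'm"
  shows "\<exists>w. T *v w = det T *s b"
proof (cases "det T = 0")
  case True
  then show ?thesis by (intro exI[of _ 0]) (simp add: vec_eq_iff matrix_vector_mult_def)
next
  case False
  define w where "w = (\<chi> k. det (\<chi> i j. if j = k then b $ i else T $ i $ j))"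
  define x where "x = (\<chi> k. det (\<chi> i j. if j = k then real_vec b $ i else real_mat T $ i $ j) / det (real_mat T))"
  have "real_mat T *v x = real_vec b"
    using False by (subst cramer) (simp_all add: x_def det_real_mat)
  moreover have "real_vec w = real_of_int (det T) *\<^sub>R x"
  proof -
    have "(\<chi> i j. if j = k then real_vec b $ i else real_mat T $ i $ j)
        = real_mat (\<chi> i j. if j = k then b $ i else T $ i $ j)" for k
      by (simp add: vec_eq_iff)
    then have "det (\<chi> i j. if j = k then real_vec b $ i else real_mat T $ i $ j)
        = real_of_int (det (\<chi> i j. if j = k then b $ i else T $ i $ j))" for k
      by (simp only: det_real_mat)
    then show ?thesis using False
      unfolding vec_eq_iff w_def x_def
      by (simp del: real_vec_nth real_mat_nth add: det_real_mat real_vec_nth[of "\<chi> k. f k" for f])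
  qed
  ultimately have "real_vec (T *v w) = real_of_int (det T) *\<^sub>R real_vec b"
    by (simp add: real_mat_mult_real_vec[symmetric] matrix_vector_mult_scaleR)
  also have "\<dots> = real_vec (det T *s b)" by (simp add: vec_eq_iff)
  finally show ?thesis by auto
qed

lemma cramer_column_int:
  fixes T :: "int ^ 'm ^ 'm"
  shows "det (\<chi> i j. if j = k then (T *v w) $ i else T $ i $ j) = w $ k * det T"
proof -
  have "real_of_int (det (\<chi> i j. if j = k then (T *v w) $ i else T $ i $ j))
      = det (\<chi> i j. if j = k then (real_mat T *v real_vec w) $ i else real_mat T $ i $ j)"
    unfolding det_real_mat[symmetric] real_mat_mult_real_vec
    by (rule arg_cong[of _ _ det]) (simp add: vec_eq_iff)
  also have "\<dots> = real_of_int (w $ k * det T)"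
    by (simp add: cramer_lemma det_real_mat)
  finally show ?thesis by linarith
qed

lemma int_matrix_mult_inj:
  fixes T :: "int ^ 'm ^ 'm"
  assumes "det T \<noteq> 0" "T *v x = T *v y"
  shows "x = y"
proof -
  have "real_mat T *v real_vec x = real_mat T *v real_vec y"
    using assms by (simp add: real_mat_mult_real_vec)
  moreover have "inj ((*v) (real_mat T))"
    using assms det_nz_iff_inj[of "(*v) (real_mat T)"] by (simp add: det_real_mat)
  ultimately show ?thesis by (metis injD real_vec_inject)
qed

lemma int_matrix_mult_scale:
  fixes T :: "int ^ 'n ^ 'm"
  shows "T *v (c *s x) = c *s (T *v x)"
  by (simp add: vec_eq_iff matrix_vector_mult_def sum_distrib_left mult_ac)

text \<open>Since \<open>det T\<close> annihilates the quotient of the integer vectors by the range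
  of \<open>T\<close>, \<open>u0\<close> has a finite order \<open>q > 1\<close> there. For a prime
  \<open>p\<close> dividing \<open>q\<close>, the multiple of \<open>u0\<close> by
  \<open>q / p\<close> has order \<open>p\<close>.\<close>

lemma prime_order_element:
  fixes T :: "int ^ 'm ^ 'm"
  assumes "det T \<noteq> 0" and "u0 \<notin> range ((*v) T)"
  obtains p :: nat and u w where "prime p" "u \<notin> range ((*v) T)" "T *v w = int p *s u"
proof -
  define P where "P q \<longleftrightarrow> 0 < q \<and> int q *s u0 \<in> range ((*v) T)" for q :: nat
  obtain w where w: "T *v w = det T *s u0" using cramer_int by blast
  have "T *v (sgn (det T) *s w) = int (nat \<bar>det T\<bar>) *s u0"
    unfolding int_matrix_mult_scale w by (simp add: vec_eq_iff abs_sgn[symmetric] mult.assoc[symmetric] mult.commute[of "sgn _"])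
  then have "P (nat \<bar>det T\<bar>)" unfolding P_def using assms by (metis rangeI zero_less_abs_iff zero_less_nat_eq)
  then have PL: "P (LEAST q. P q)" by (rule LeastI)
  define q where "q = (LEAST q. P q)"
  have Pq: "P q" using PL by (simp add: q_def)
  have "q \<noteq> 1"
  proof
    assume "q = 1"
    with Pq have "1 *s u0 \<in> range ((*v) T)" by (simp add: P_def)
    moreover have "(1::int) *s u0 = u0" by (simp add: vec_eq_iff)
    ultimately show False using assms by simp
  qed
  then obtain p where p: "prime p" "p dvd q" using prime_factor_nat by blast
  then obtain q' where q': "q = p * q'" by (elim dvdE)
  have "0 < q'" "q' < q" using Pq q' p prime_gt_1_nat[of p] by (auto simp: P_def)
  then have "\<not> P q'" using not_less_Least[of q' P] by (simp add: q_def)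
  then have u: "int q' *s u0 \<notin> range ((*v) T)" using \<open>0 < q'\<close> by (simp add: P_def)
  obtain w where "int q *s u0 = T *v w" using Pq by (auto simp: P_def)
  then have "T *v w = int p *s (int q' *s u0)" using q' by (simp add: vec_eq_iff mult_ac)
  with p u show ?thesis using that by blast
qed

text \<open>If \<open>T \<int>\<^sup>m\<close> is not all of \<open>\<int>\<^sup>m\<close>, adjoin an
  element \<open>u\<close> of prime order \<open>p\<close> modulo the lattice; after normalising, \<open>u\<close> can replace a column of
  \<open>T\<close>, which divides the determinant by \<open>p\<close>.\<close>

lemma incongruent_representatives:
  fixes T :: "int ^ 'm ^ 'm"
  assumes "det T \<noteq> 0"
  shows "\<exists>R. finite R \<and> int (card R) = \<bar>det T\<bar> \<and>
    (\<forall>r\<in>R. \<forall>r'\<in>R. \<forall>w. r - r' = T *v w \<longrightarrow> r = r')"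
  using assms
proof (induction "nat \<bar>det T\<bar>" arbitrary: T rule: less_induct)
  case less
  show ?case
  proof (cases "range ((*v) T) = UNIV")
    case True
    \<comment> \<open>A surjective \<open>T\<close> has an integral right inverse, so its
      determinant is a unit and one representative suffices.\<close>
    then have "\<forall>k. \<exists>w. T *v w = axis k 1" by (metis UNIV_I imageE)
    then obtain S where S: "\<And>k. T *v S k = axis k 1" by metis
    have "T ** (\<chi> i k. S k $ i) = mat 1"
    proof -
      have "(T ** (\<chi> i k. S k $ i)) $ i $ k = (T *v S k) $ i" for i k
        by (simp add: matrix_matrix_mult_def matrix_vector_mult_def)
      then show ?thesis by (simp add: S vec_eq_iff mat_def axis_def)
    qed
    then have "det T * det (\<chi> i k. S k $ i) = 1"
      by (metis det_I det_mul)
    then have "\<bar>det T\<bar> = 1" by (metis abs_mult abs_1 zmult_eq_1_iff abs_zmult_eq_1)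
    then show ?thesis by (intro exI[of _ "{0}"]) simp
  next
    case False
    then obtain u0 where "u0 \<notin> range ((*v) T)" by blast
    then obtain p :: nat and u w where p: "prime p" and u: "u \<notin> range ((*v) T)"
      and w: "T *v w = int p *s u"
      using prime_order_element less.prems by metis
    \<comment> \<open>Otherwise \<open>w\<close> could be divided by \<open>p\<close>, which would
      put \<open>u\<close> into the lattice.\<close>
    have "\<exists>k. \<not> int p dvd w $ k"
    proof (rule ccontr)
      assume "\<not> ?thesis"
      then have "w = int p *s (\<chi> k. w $ k div int p)" by (simp add: vec_eq_iff)
      then have "int p *s (T *v (\<chi> k. w $ k div int p)) = int p *s u"
        using w int_matrix_mult_scale by metis
      then have "T *v (\<chi> k. w $ k div int p) = u"
        using p by (simp add: vec_eq_iff prime_gt_0_nat)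
      then show False using u by blast
    qed
    then obtain k where "\<not> int p dvd w $ k" by blast
    then have "coprime (int p) (w $ k)"
      using p by (intro prime_imp_coprime) auto
    then obtain a z0 where az: "z0 * int p + a * w $ k = 1"
      using bezout_int[of "int p" "w $ k"] by (auto simp: coprime_iff_gcd_eq_1)
    \<comment> \<open>Normalisation: by Bezout the \<open>k\<close>-th coefficient of
      \<open>w'\<close> is \<open>a * w $ k + z0 * int p = 1\<close>, so column \<open>k\<close> of
      \<open>T\<close> becomes an integral combination of \<open>int p *s u'\<close> and the other
      columns.\<close>
    define u' where "u' = a *s u + z0 *s column k T"
    define w' where "w' = a *s w + (z0 * int p) *s axis k 1"
    have Taxis: "T *v axis k 1 = column k T"
      by (simp add: vec_eq_iff matrix_vector_mult_def column_def axis_def if_distrib cong: if_cong)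
    have w': "T *v w' = int p *s u'" and w'k: "w' $ k = 1"
      unfolding w'_def u'_def matrix_vector_right_distrib int_matrix_mult_scale w Taxis
      using az by (simp_all add: vec_eq_iff algebra_simps axis_def)
    define T' where "T' = (\<chi> i j. if j = k then u' $ i else T $ i $ j)"
    have "int p * det T' = det (\<chi> i j. if j = k then (T *v w') $ i else T $ i $ j)"
    proof -
      have eq: "det (\<chi> i j. if j = k then c $ i else T $ i $ j) =
        det (\<chi> i. if i = k then c else row i (transpose T))" for c :: "int ^ 'm"
        by (subst det_transpose[symmetric], rule arg_cong[of _ _ det]) (simp add: vec_eq_iff transpose_def row_def)
      have "int p * det T' = int p * det (\<chi> i. if i = k then u' else row i (transpose T))"
        using eq[of u'] by (simp add: T'_def cong: if_cong)
      also have "\<dots> = det (\<chi> i. if i = k then int p *s u' else row i (transpose T))"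
        by (rule det_row_mul[symmetric])
      also have "\<dots> = det (\<chi> i j. if j = k then (T *v w') $ i else T $ i $ j)"
        using eq[of "T *v w'"] by (simp add: w' cong: if_cong)
      finally show ?thesis .
    qed
    then have detT': "int p * det T' = det T" by (simp add: cramer_column_int w'k)
    then have "det T' \<noteq> 0" using less.prems by auto
    moreover have abs: "\<bar>det T\<bar> = int p * \<bar>det T'\<bar>" using detT' by (simp add: abs_mult flip: detT')
    then have "\<bar>det T'\<bar> < \<bar>det T\<bar>"
      using p \<open>det T' \<noteq> 0\<close> prime_gt_1_nat[OF p] by simp
    ultimately obtain R where R: "finite R" "int (card R) = \<bar>det T'\<bar>"
      and inc: "\<And>r r' w. \<lbrakk>r \<in> R; r' \<in> R; r - r' = T' *v w\<rbrakk> \<Longrightarrow> r = r'"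
      using less.hyps[of T'] less.prems by (auto simp: nat_less_eq_zless)
    have T'mult: "T' *v x = T *v (\<chi> j. if j = k then 0 else x $ j) + x $ k *s u'" for x
      unfolding vec_eq_iff
    proof
      fix i
      have "(T' *v x) $ i = (\<Sum>j\<in>UNIV. (if j = k then 0 else T $ i $ j * x $ j) + (if j = k then x $ k * u' $ i else 0))"
        unfolding matrix_vector_mult_def T'_def by (auto intro!: sum.cong)
      also have "\<dots> = (T *v (\<chi> j. if j = k then 0 else x $ j) + x $ k *s u') $ i"
        unfolding sum.distrib by (simp add: matrix_vector_mult_def if_distrib cong: if_cong)
      finally show "(T' *v x) $ i = (T *v (\<chi> j. if j = k then 0 else x $ j) + x $ k *s u') $ i" .
    qed
    \<comment> \<open>The lattice of \<open>T'\<close> contains that of \<open>T\<close> and the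
      vector \<open>u'\<close>. The witness \<open>y\<close> comes from substituting for column
      \<open>k\<close> by means of \<open>T *v w' = int p *s u'\<close>.\<close>
    have TT': "\<exists>y. T *v x + c *s u' = T' *v y" for x c
    proof -
      define y where "y = (\<chi> j. if j = k then c + int p * x $ k else x $ j - x $ k * w' $ j)"
      have "(\<chi> j. if j = k then 0 else y $ j) = x - x $ k *s w'"
        using w'k by (simp add: vec_eq_iff y_def)
      then have "T' *v y = T *v (x - x $ k *s w') + (c + int p * x $ k) *s u'"
        unfolding T'mult by (simp add: y_def)
      also have "\<dots> = T *v x + c *s u'"
        unfolding matrix_vector_mult_diff_distrib int_matrix_mult_scale w'
        by (simp add: vec_eq_iff algebra_simps)
      finally show ?thesis by metis
    qed
    \<comment> \<open>The multiples \<open>a *s u'\<close> with \<open>0 \<le> a < p\<close> are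
      pairwise incongruent modulo \<open>T\<close>, so each element of \<open>R\<close> yields
      \<open>p\<close> representatives.\<close>
    define Q where "Q = (\<lambda>(r, a). r + int a *s u') ` (R \<times> {..<p})"
    \<comment> \<open>Congruence modulo \<open>T\<close> implies congruence modulo
      \<open>T'\<close>, hence \<open>r = r'\<close>. Then \<open>w' $ k = 1\<close> forces
      \<open>p\<close> to divide \<open>a - a'\<close>, and both numbers are below
      \<open>p\<close>.\<close>
    have key: "r = r' \<and> a = a'" if "r \<in> R" "r' \<in> R" "a < p" "a' < p"
      "(r + int a *s u') - (r' + int a' *s u') = T *v x" for r r' a a' x
    proof -
      have e: "r - r' = T *v x + (int a' - int a) *s u'"
        using that(5) by (simp add: vec_eq_iff algebra_simps)
      then have "r = r'" using inc that TT' by metis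
      then have "T *v x = (int a - int a') *s u'"
        using e by (simp add: vec_eq_iff algebra_simps)
      then have "int p *s (T *v x) = int p *s ((int a - int a') *s u')" by simp
      also have "\<dots> = T *v ((int a - int a') *s w')"
        unfolding int_matrix_mult_scale w' by (simp add: vec_eq_iff algebra_simps)
      finally have "T *v (int p *s x) = T *v ((int a - int a') *s w')"
        by (simp add: int_matrix_mult_scale)
      then have "int p *s x = (int a - int a') *s w'"
        using int_matrix_mult_inj less.prems by blast
      then have "int p * x $ k = int a - int a'"
        using w'k by (metis mult.right_neutral vector_smult_component)
      then have "int p dvd int a - int a'" by (metis dvd_triv_left)
      then have "int a = int a'"
        using dvd_imp_le_int[of "int a - int a'" "int p"] that by fastforce
      then show ?thesis using \<open>r = r'\<close> by simp
    qed
    have "inj_on (\<lambda>(r, a). r + int a *s u') (R \<times> {..<p})"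
      using key[where x = 0] by (auto simp: inj_on_def)
    then have "card Q = card R * p" unfolding Q_def by (simp add: card_image card_cartesian_product)
    then have "int (card Q) = \<bar>det T\<bar>" using R abs by simp
    moreover have "\<forall>r\<in>Q. \<forall>r'\<in>Q. \<forall>w. r - r' = T *v w \<longrightarrow> r = r'"
      unfolding Q_def using key by fastforce
    moreover have "finite Q" using R by (simp add: Q_def)
    ultimately show ?thesis by blast
  qed
qed

subsection \<open>The Cauchy-Binet formula for the Gram determinant\<close>

definition column_submatrix :: "'a ^ 'n ^ 'm \<Rightarrow> ('m \<Rightarrow> 'n) \<Rightarrow> 'a ^ 'm ^ 'm" where
  "column_submatrix A f = (\<chi> i j. A $ i $ f j)"

lemma column_submatrix_nth [simp]: "column_submatrix A f $ i $ j = A $ i $ f j"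
  by (simp add: column_submatrix_def)

lemma maximal_minors_alt: "maximal_minors A = (\<lambda>f. det (column_submatrix A f)) ` {f. inj f}"
  by (auto simp: maximal_minors_def column_submatrix_def)

lemma det_column_submatrix_not_inj:
  fixes A :: "'a::comm_ring_1 ^ 'n ^ 'm"
  assumes "\<not> inj f"
  shows "det (column_submatrix A f) = 0"
proof -
  obtain i j where "i \<noteq> j" "f i = f j" using assms by (auto simp: inj_def)
  then show ?thesis
    by (intro det_identical_columns[of i j]) (auto simp: column_def)
qed

text \<open>Expanding the product of row sums in the Leibniz formula picks a column
  \<open>f i\<close> for each row \<open>i\<close>; for fixed \<open>f\<close>, the sum over
  permutations is again a determinant.\<close>

lemma det_mult_transpose_expand:
  fixes A :: "'a::comm_ring_1 ^ 'n ^ 'm"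
  shows "det (A ** transpose A) = (\<Sum>f\<in>UNIV. (\<Prod>i\<in>UNIV. A $ i $ f i) * det (column_submatrix A f))"
proof -
  let ?P = "{p. p permutes (UNIV :: 'm set)}"
  have "det (A ** transpose A)
      = (\<Sum>p\<in>?P. of_int (sign p) * (\<Prod>i\<in>UNIV. \<Sum>k\<in>UNIV. A $ i $ k * A $ p i $ k))"
    by (simp add: det_def matrix_matrix_mult_def transpose_def)
  also have "\<dots> = (\<Sum>p\<in>?P. of_int (sign p) * (\<Sum>f\<in>UNIV. \<Prod>i\<in>UNIV. A $ i $ f i * A $ p i $ f i))"
    by (subst prod_sum_PiE) (auto simp: PiE_UNIV_domain)
  also have "\<dots> = (\<Sum>f\<in>UNIV. \<Sum>p\<in>?P. of_int (sign p) * (\<Prod>i\<in>UNIV. A $ i $ f i * A $ p i $ f i))"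
    unfolding sum_distrib_left by (rule sum.swap)
  also have "\<dots> = (\<Sum>f\<in>UNIV. (\<Prod>i\<in>UNIV. A $ i $ f i) * det (transpose (column_submatrix A f)))"
    unfolding det_def by (intro sum.cong refl)
      (simp add: sum_distrib_left prod.distrib transpose_def mult_ac)
  finally show ?thesis by simp
qed

text \<open>Precomposing \<open>f\<close> with a permutation only multiplies its minor by a sign.
  Summing the expansion over all permutations therefore turns the product of entries into a second
  copy of the minor. The factorial counts the orderings of each column set.\<close>

lemma cauchy_binet_gram:
  fixes A :: "'a::comm_ring_1 ^ 'n ^ 'm"
  shows "of_nat (fact CARD('m)) * det (A ** transpose A)
    = (\<Sum>f | inj f. (det (column_submatrix A f))\<^sup>2)"
proof -
  let ?P = "{p. p permutes (UNIV :: 'm set)}"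
  define g where "g f = (\<Prod>i\<in>UNIV. A $ i $ f i) * det (column_submatrix A f)" for f
  have reindex: "(\<Sum>f\<in>UNIV. g f) = (\<Sum>f\<in>UNIV. g (f \<circ> p))" if "p \<in> ?P" for p
  proof -
    have "bij_betw (\<lambda>f. f \<circ> p) UNIV (UNIV :: ('m \<Rightarrow> 'n) set)"
      using that by (intro bij_betw_byWitness[where f' = "\<lambda>f. f \<circ> inv p"])
        (auto simp: o_assoc[symmetric] permutes_inv_o)
    then show ?thesis by (rule sum.reindex_bij_betw[symmetric])
  qed
  have perm: "det (column_submatrix A (f \<circ> p)) = of_int (sign p) * det (column_submatrix A f)"
    if "p \<in> ?P" for f p
    using det_permute_columns[of p "column_submatrix A f"] that by (simp add: column_submatrix_def)
  have "of_nat (fact CARD('m)) * (\<Sum>f\<in>UNIV. g f) = (\<Sum>p\<in>?P. \<Sum>f\<in>UNIV. g f)"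
    by (simp add: card_permutations)
  also have "\<dots> = (\<Sum>p\<in>?P. \<Sum>f\<in>UNIV. g (f \<circ> p))"
    using reindex by (rule sum.cong[OF refl])
  also have "\<dots> = (\<Sum>f\<in>UNIV. \<Sum>p\<in>?P. g (f \<circ> p))"
    by (rule sum.swap)
  also have "\<dots> = (\<Sum>f\<in>UNIV. (det (column_submatrix A f))\<^sup>2)"
  proof (rule sum.cong[OF refl])
    fix f :: "'m \<Rightarrow> 'n"
    have "(\<Sum>p\<in>?P. g (f \<circ> p))
        = (\<Sum>p\<in>?P. of_int (sign p) * (\<Prod>i\<in>UNIV. A $ i $ f (p i)) * det (column_submatrix A f))"
      by (intro sum.cong refl) (simp add: g_def perm mult_ac)
    also have "\<dots> = (det (column_submatrix A f))\<^sup>2"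
      by (simp add: sum_distrib_right[symmetric] power2_eq_square det_def[of "column_submatrix A f"])
    finally show "(\<Sum>p\<in>?P. g (f \<circ> p)) = (det (column_submatrix A f))\<^sup>2" .
  qed
  also have "\<dots> = (\<Sum>f | inj f. (det (column_submatrix A f))\<^sup>2)"
    by (rule sum.mono_neutral_right) (auto simp: det_column_submatrix_not_inj)
  finally show ?thesis by (simp add: det_mult_transpose_expand g_def)
qed

lemma card_inj_functions:
  "card {f :: 'm::finite \<Rightarrow> 'n::finite. inj f} = fact CARD('m) * (CARD('n) choose CARD('m))"
proof -
  have "card {f :: 'm \<Rightarrow> 'n. inj f} = (\<Prod>i = 0..<CARD('m). CARD('n) - i)"
    using card_inj_on_subset_funcset[of "UNIV :: 'm set" "UNIV :: 'n set" "UNIV :: 'm set"]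
    by (simp add: PiE_UNIV_domain)
  also have "\<dots> = fact CARD('m) * (CARD('n) choose CARD('m))"
  proof (cases "CARD('m) \<le> CARD('n)")
    case True
    have "real (\<Prod>i = 0..<CARD('m). CARD('n) - i) = (\<Prod>i = 0..<CARD('m). real CARD('n) - real i)"
      unfolding of_nat_prod using True by (intro prod.cong) auto
    also have "\<dots> = real (fact CARD('m) * (CARD('n) choose CARD('m)))"
      by (simp add: gbinomial_mult_fact[symmetric] binomial_gbinomial)
    finally show ?thesis by linarith
  next
    case False
    then have "(\<Prod>i = 0..<CARD('m). CARD('n) - i) = 0"
      by (intro prod_zero) (auto intro: bexI[of _ "CARD('n)"])
    moreover have "CARD('n) choose CARD('m) = 0" using False by (simp add: binomial_eq_0)
    ultimately show ?thesis by (metis mult_0_right)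
  qed
  finally show ?thesis .
qed

text \<open>After cancelling the orderings, Cauchy-Binet has one squared minor for each column set,
  and \<open>d! * (n choose d) \<le> n ^ d\<close>.\<close>

lemma det_gram_le:
  fixes A :: "int ^ 'n ^ 'm"
  assumes "CARD('m) \<le> CARD('n)" "\<And>f. inj f \<Longrightarrow> \<bar>det (column_submatrix A f)\<bar> \<le> M"
  shows "fact (CARD('n) - CARD('m)) * det (A ** transpose A) \<le> int CARD('n) ^ (CARD('n) - CARD('m)) * M\<^sup>2"
proof -
  let ?d = "CARD('n) - CARD('m)"
  have sq: "(det (column_submatrix A f))\<^sup>2 \<le> M\<^sup>2" if "inj f" for f
    using assms(2)[OF that] by (metis abs_ge_zero power2_abs power_mono)
  have "fact CARD('m) * det (A ** transpose A) = (\<Sum>f | inj f. (det (column_submatrix A f))\<^sup>2)"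
    using cauchy_binet_gram[of A] by simp
  also have "\<dots> \<le> (\<Sum>f | inj (f :: 'm \<Rightarrow> 'n). M\<^sup>2)"
    using sq by (intro sum_mono) auto
  also have "\<dots> = fact CARD('m) * (int (CARD('n) choose CARD('m)) * M\<^sup>2)"
    by (simp add: card_inj_functions)
  finally have "det (A ** transpose A) \<le> int (CARD('n) choose CARD('m)) * M\<^sup>2"
    by (simp add: fact_gt_zero)
  also have "CARD('n) choose CARD('m) = CARD('n) choose ?d"
    using assms(1) by (rule binomial_symmetric)
  finally have "fact ?d * det (A ** transpose A) \<le> fact ?d * (int (CARD('n) choose ?d) * M\<^sup>2)"
    by (intro mult_left_mono) auto
  also have "\<dots> = int ((CARD('n) choose ?d) * fact ?d) * M\<^sup>2" by simp
  also have "\<dots> \<le> int (CARD('n) ^ ?d) * M\<^sup>2"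
    by (intro mult_right_mono zle_int[THEN iffD2] binomial_fact_pow) auto
  finally show ?thesis by simp
qed

subsection \<open>A facet of the cone of columns\<close>

text \<open>The image of the standard simplex under \<open>A\<close> is compact and convex and, by
  the hypothesis, misses the origin; a hyperplane strictly separating the two gives the
  functional.\<close>

lemma positive_functional_exists:
  fixes A :: "real ^ 'n ^ 'm"
  assumes "\<And>x. \<lbrakk>\<And>k. 0 \<le> x $ k; A *v x = 0\<rbrakk> \<Longrightarrow> x = 0"
  obtains y where "\<And>k. 0 < y \<bullet> column k A"
proof -
  define K :: "(real ^ 'n) set" where "K = cbox 0 1 \<inter> {x. 1 \<bullet> x = 1}"
  define S where "S = (*v) A ` K"
  have axis_K: "axis k 1 \<in> K" for k
  proof -
    have "axis k 1 \<in> (cbox 0 1 :: (real ^ 'n) set)"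
      by (simp add: mem_box_cart axis_def)
    moreover have "(1 :: real ^ 'n) \<bullet> axis k 1 = 1"
      by (simp add: inner_axis)
    ultimately show ?thesis by (simp add: K_def)
  qed
  have "convex S" unfolding S_def K_def
    by (intro convex_linear_image convex_Int convex_box convex_hyperplane) auto
  moreover have "compact S" unfolding S_def K_def
    by (intro compact_continuous_image compact_Int_closed compact_cbox closed_hyperplane
        linear_continuous_on matrix_vector_mul_bounded_linear)
  moreover have "S \<noteq> {}" using axis_K by (auto simp: S_def)
  moreover have "0 \<notin> S"
  proof
    assume "0 \<in> S"
    then obtain x where x: "x \<in> K" "A *v x = 0" by (auto simp: S_def)
    then have "x = 0" using assms by (auto simp: K_def mem_box_cart)
    then show False using x by (simp add: K_def)
  qed
  ultimately obtain y b where "0 < b" "\<And>x. x \<in> S \<Longrightarrow> y \<bullet> x > b"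
    using separating_hyperplane_closed_0_inset[of S] compact_imp_closed by metis
  moreover have "column k A \<in> S" for k
    using axis_K[of k] by (auto simp: S_def matrix_vector_mult_basis[symmetric])
  ultimately show ?thesis using that[of y] by (meson less_trans)
qed

text \<open>A nonnegative functional with the largest number of zeros supports a facet: otherwise it can
  be tilted, keeping its zeros, until it vanishes on a further vector.\<close>

lemma facet_functional_exists:
  fixes a :: "'n::finite \<Rightarrow> real ^ 'm"
  assumes card: "CARD('m) \<le> CARD('n)"
    and general_position: "\<And>K y. \<lbrakk>card K = CARD('m); \<And>k. k \<in> K \<Longrightarrow> y \<bullet> a k = 0\<rbrakk> \<Longrightarrow> y = 0"
    and pos: "\<And>k. 0 < y0 \<bullet> a k"
  shows "\<exists>y. y \<noteq> 0 \<and> (\<forall>k. 0 \<le> y \<bullet> a k) \<and> Suc (card {k. y \<bullet> a k = 0}) = CARD('m)"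
proof -
  define P where "P y \<longleftrightarrow> y \<noteq> 0 \<and> (\<forall>k. 0 \<le> y \<bullet> a k)" for y
  define Z where "Z y = {k. y \<bullet> a k = 0}" for y
  have "P y0" using pos by (auto simp: P_def less_imp_le)
  moreover have "\<forall>y. P y \<longrightarrow> card (Z y) < Suc CARD('n)"
    by (auto simp: less_Suc_eq_le card_mono)
  ultimately obtain y where y: "P y" and max: "\<And>z. P z \<Longrightarrow> card (Z z) \<le> card (Z y)"
    using ex_has_greatest_nat[of P y0 "\<lambda>y. card (Z y)" "Suc CARD('n)"] by auto
  have "card (Z y) < CARD('m)"
  proof (rule ccontr)
    assume "\<not> ?thesis"
    then obtain K where "K \<subseteq> Z y" "card K = CARD('m)"
      by (meson not_less obtain_subset_with_card_n)
    then have "y = 0" by (intro general_position) (auto simp: Z_def)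
    then show False using y by (simp add: P_def)
  qed
  moreover have "\<not> Suc (card (Z y)) < CARD('m)"
  proof
    assume less: "Suc (card (Z y)) < CARD('m)"
    have "dim (insert y (a ` Z y)) \<le> card (insert y (a ` Z y))"
      by (intro dim_le_card') auto
    also have "\<dots> \<le> Suc (card (Z y))"
      using card_image_le[of "Z y" a] by (simp add: card_insert_if)
    finally have "dim (insert y (a ` Z y)) < DIM(real ^ 'm)" using less by simp
    \<comment> \<open>The zeros of \<open>y\<close> together with \<open>y\<close> itself span a
      proper subspace, which leaves a direction \<open>v\<close> for tilting.\<close>
    then obtain v where v: "v \<noteq> 0" "\<And>x. x \<in> span (insert y (a ` Z y)) \<Longrightarrow> orthogonal v x"
      using orthogonal_to_subspace_exists by blast
    have vZ: "v \<bullet> a k = 0" if "k \<in> Z y" for k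
      using v(2)[of "a k"] that by (auto simp: orthogonal_def span_base)
    have vy: "v \<bullet> y = 0" using v(2)[of y] by (auto simp: orthogonal_def span_base)
    have "\<exists>k. v \<bullet> a k \<noteq> 0"
    proof (rule ccontr)
      assume "\<not> ?thesis"
      moreover obtain K :: "'n set" where "card K = CARD('m)"
        using obtain_subset_with_card_n[OF card] by blast
      ultimately show False using general_position[of K v] v(1) by auto
    qed
    then obtain k0 where k0: "v \<bullet> a k0 \<noteq> 0" by blast
    \<comment> \<open>The sign is chosen so that moving along \<open>w\<close> decreases the value
      on at least one vector.\<close>
    define w where "w = (if v \<bullet> a k0 < 0 then v else - v)"
    have w: "w \<bullet> y = 0" "\<And>k. k \<in> Z y \<Longrightarrow> w \<bullet> a k = 0" "w \<bullet> a k0 < 0"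
      using vy vZ k0 by (auto simp: w_def)
    define N where "N = {k. w \<bullet> a k < 0}"
    \<comment> \<open>\<open>r k\<close> is the step length at which
      \<open>y + r k *\<^sub>R w\<close> vanishes on \<open>a k\<close>. The smallest one over
      \<open>N\<close> keeps all values nonnegative and creates a new zero.\<close>
    define r where "r k = (y \<bullet> a k) / - (w \<bullet> a k)" for k
    have "finite (r ` N)" "r ` N \<noteq> {}" using w by (auto simp: N_def)
    then have "Min (r ` N) \<in> r ` N" and Min_le: "\<And>k. k \<in> N \<Longrightarrow> Min (r ` N) \<le> r k" by auto
    then obtain k1 where k1: "k1 \<in> N" "Min (r ` N) = r k1" by auto
    define z where "z = y + r k1 *\<^sub>R w"
    have rk1: "0 \<le> r k1" using k1 y by (auto simp: r_def N_def P_def intro!: divide_nonneg_neg)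
    \<comment> \<open>Orthogonality of \<open>w\<close> to \<open>y\<close> ensures that the tilted
      functional is not zero.\<close>
    have "z \<bullet> y = y \<bullet> y" using w by (simp add: z_def inner_left_distrib)
    then have "z \<noteq> 0" using y by (auto simp: P_def)
    moreover have "0 \<le> z \<bullet> a k" for k
    proof (cases "k \<in> N")
      case True
      then have "r k1 \<le> r k" using Min_le k1 by simp
      then have "r k1 * - (w \<bullet> a k) \<le> r k * - (w \<bullet> a k)"
        using True by (intro mult_right_mono) (auto simp: N_def)
      also have "\<dots> = y \<bullet> a k" using True by (simp add: r_def N_def)
      finally show ?thesis by (simp add: z_def inner_left_distrib)
    next
      case False
      then show ?thesis using y rk1 by (simp add: z_def inner_left_distrib N_def P_def)
    qed
    ultimately have "P z" by (simp add: P_def)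
    have "insert k1 (Z y) \<subseteq> Z z"
      using w(2) k1(1) by (auto simp: Z_def z_def inner_left_distrib inner_diff_left r_def N_def)
    then have "card (insert k1 (Z y)) \<le> card (Z z)" by (intro card_mono) auto
    moreover have "k1 \<notin> Z y" using w k1 by (auto simp: N_def)
    ultimately show False using max[OF \<open>P z\<close>] by simp
  qed
  ultimately have "Suc (card (Z y)) = CARD('m)" by linarith
  then show ?thesis using y by (auto simp: P_def Z_def)
qed

lemma matrix_vector_mult_columns:
  fixes T :: "real ^ 'n ^ 'm"
  shows "y \<bullet> (T *v x) = (\<Sum>j\<in>UNIV. x $ j * (y \<bullet> column j T))"
  by (simp add: matrix_mult_sum inner_sum_right scalar_mult_eq_scaleR)

text \<open>Take the columns on a facet and one further column \<open>j\<close> as a basis. The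
  facet functional sees only the \<open>j\<close>-coordinate of a column, which Cramer's rule gives
  as a quotient of maximal minors with common denominator \<open>det T\<close>.\<close>

lemma facet_minors:
  fixes A :: "int ^ 'n ^ 'm"
  assumes card: "CARD('m) < CARD('n)"
    and minors: "\<And>f. inj f \<Longrightarrow> det (column_submatrix A f) \<noteq> 0"
    and pointed: "solution_polyhedron A 0 = {0}"
  obtains f i0 y where "inj f"
    "\<And>k. y \<bullet> column k (real_mat A) =
      (if k \<in> f ` (- {i0}) then 0 else real_of_int \<bar>det (column_submatrix A (f(i0 := k)))\<bar>)"
proof -
  define a where "a k = column k (real_mat A)" for k
  have column_sub: "column i (real_mat (column_submatrix A f)) = a (f i)" for f i
    by (simp add: column_def a_def)
  have "x = 0" if "\<And>k. 0 \<le> x $ k" "real_mat A *v x = 0" for x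
    using pointed that by (auto simp: solution_polyhedron_def)
  from positive_functional_exists[OF this] obtain y0 where y0: "\<And>k. 0 < y0 \<bullet> a k"
    unfolding a_def by blast
  \<comment> \<open>Any \<open>m\<close> columns form a basis, so \<open>y\<close> is a combination
    of vectors orthogonal to it.\<close>
  have gp: "y = 0" if K: "card K = CARD('m)" "\<And>k. k \<in> K \<Longrightarrow> y \<bullet> a k = 0" for K y
  proof -
    obtain f :: "'m \<Rightarrow> 'n" where f: "bij_betw f UNIV K"
      using finite_same_card_bij[of "UNIV :: 'm set" K] K by auto
    then have "inj f" by (simp add: bij_betw_def)
    define T where "T = real_mat (column_submatrix A f)"
    have "det T \<noteq> 0" using minors[OF \<open>inj f\<close>] by (simp add: T_def det_real_mat)
    then obtain x where "T *v x = y" using cramer[of T _ y] by blast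
    then have "y \<bullet> y = (\<Sum>j\<in>UNIV. x $ j * (y \<bullet> a (f j)))"
      using matrix_vector_mult_columns[of y T x] by (simp add: T_def column_sub)
    also have "\<dots> = 0" using K(2) f by (intro sum.neutral) (auto simp: bij_betw_def)
    finally show ?thesis by simp
  qed
  have "\<exists>y. y \<noteq> 0 \<and> (\<forall>k. 0 \<le> y \<bullet> a k) \<and> Suc (card {k. y \<bullet> a k = 0}) = CARD('m)"
  proof (rule facet_functional_exists)
    show "CARD('m) \<le> CARD('n)" using card by simp
    show "0 < y0 \<bullet> a k" for k by (rule y0)
    show "y = 0" if "card K = CARD('m)" "\<And>k. k \<in> K \<Longrightarrow> y \<bullet> a k = 0" for K y
      using that by (rule gp)
  qed
  then obtain y where y: "y \<noteq> 0" "\<And>k. 0 \<le> y \<bullet> a k" "Suc (card {k. y \<bullet> a k = 0}) = CARD('m)"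
    by blast
  define Z where "Z = {k. y \<bullet> a k = 0}"
  have "card Z < CARD('n)" using y card by (simp add: Z_def)
  then obtain j where j: "j \<notin> Z" by (metis UNIV_eq_I less_irrefl)
  have "card (insert j Z) = CARD('m)" using y j by (simp add: Z_def)
  then obtain f :: "'m \<Rightarrow> 'n" where f: "bij_betw f UNIV (insert j Z)"
    using finite_same_card_bij[of "UNIV :: 'm set" "insert j Z"] by auto
  then have inj: "inj f" by (simp add: bij_betw_def)
  have "j \<in> range f" using f by (simp add: bij_betw_def)
  then obtain i0 where i0: "f i0 = j" by blast
  have Z: "f ` (- {i0}) = Z"
  proof -
    have "f ` (- {i0}) = f ` UNIV - {j}" using inj i0 by (auto simp: inj_def)
    then show ?thesis using f j by (auto simp: bij_betw_def)
  qed
  define T where "T = real_mat (column_submatrix A f)"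
  have detT: "det T \<noteq> 0" using minors[OF inj] by (simp add: T_def det_real_mat)
  have yj: "0 < y \<bullet> a j" using y(2)[of j] j by (auto simp: Z_def less_le)
  \<comment> \<open>The scaling gives column \<open>j\<close> the value
    \<open>\<bar>det T\<bar>\<close>, which clears the Cramer denominator.\<close>
  define y' where "y' = (\<bar>det T\<bar> / (y \<bullet> a j)) *\<^sub>R y"
  have "y' \<bullet> a k = (if k \<in> f ` (- {i0}) then 0 else real_of_int \<bar>det (column_submatrix A (f(i0 := k)))\<bar>)" for k
  proof (cases "k \<in> Z")
    case True
    then show ?thesis by (simp add: Z) (simp add: y'_def Z_def)
  next
    case False
    obtain x where x: "T *v x = a k" using detT cramer[of T _ "a k"] by blast
    have "y \<bullet> a k = (\<Sum>i\<in>UNIV. x $ i * (y \<bullet> a (f i)))"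
      using matrix_vector_mult_columns[of y T x] by (simp add: x) (simp add: T_def column_sub)
    also have "\<dots> = (\<Sum>i\<in>{i0}. x $ i * (y \<bullet> a (f i)))"
      using Z by (intro sum.mono_neutral_right) (auto simp: Z_def)
    finally have yk: "y \<bullet> a k = x $ i0 * (y \<bullet> a j)" by (simp add: i0)
    \<comment> \<open>Nonnegativity of the functional fixes the sign, so the value is the absolute
      value of the minor.\<close>
    have "0 \<le> x $ i0" using y(2)[of k] yj by (simp add: yk zero_le_mult_iff)
    have "real_of_int (det (column_submatrix A (f(i0 := k))))
        = det (\<chi> i j. if j = i0 then (T *v x) $ i else T $ i $ j)"
      unfolding det_real_mat[symmetric] x
      by (rule arg_cong[of _ _ det]) (simp add: vec_eq_iff T_def a_def column_def)
    also have "\<dots> = x $ i0 * det T" by (rule cramer_lemma)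
    finally have "real_of_int \<bar>det (column_submatrix A (f(i0 := k)))\<bar> = x $ i0 * \<bar>det T\<bar>"
      using \<open>0 \<le> x $ i0\<close> by (simp add: abs_mult)
    then show ?thesis using False yj by (simp add: Z) (simp add: y'_def yk)
  qed
  then show ?thesis using that[of f y' i0] inj by (simp add: a_def)
qed

subsection \<open>Counting solutions near a facet\<close>

lemma column_cone_eq:
  fixes A :: "int ^ 'n ^ 'm"
  shows "column_cone A = (*v) (real_mat A) ` {x. \<forall>k. 0 \<le> x $ k}" (is "_ = ?C")
proof
  have "convex_cone ?C"
    unfolding convex_cone_iff
  proof (intro conjI ballI allI impI)
    show "0 \<in> ?C" by (rule image_eqI[of _ _ 0]) auto
    show "b + b' \<in> ?C" if "b \<in> ?C" "b' \<in> ?C" for b b'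
      using that by (auto simp: matrix_vector_right_distrib[symmetric])
    show "r *\<^sub>R b \<in> ?C" if "b \<in> ?C" "0 \<le> r" for b r
      using that by (auto simp: matrix_vector_mult_scaleR[symmetric])
  qed
  moreover have "columns (real_mat A) \<subseteq> ?C"
  proof
    fix b assume "b \<in> columns (real_mat A)"
    then obtain k where "b = real_mat A *v axis k 1"
      by (auto simp: columns_def matrix_vector_mult_basis)
    then show "b \<in> ?C" by (auto simp: axis_def)
  qed
  ultimately show "column_cone A \<subseteq> ?C"
    unfolding column_cone_def by (rule hull_minimal[rotated])
next
  show "?C \<subseteq> column_cone A"
  proof clarify
    fix x :: "real ^ 'n" assume x: "\<forall>k. 0 \<le> x $ k"
    have "(\<Sum>k\<in>F. x $ k *\<^sub>R column k (real_mat A)) \<in> column_cone A" if "finite F" for F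
      using that
    proof induction
      case empty
      then show ?case by (simp add: column_cone_def convex_cone_hull_contains_0)
    next
      case (insert k F)
      have "column k (real_mat A) \<in> column_cone A"
        unfolding column_cone_def by (intro hull_inc) (auto simp: columns_def)
      then have "x $ k *\<^sub>R column k (real_mat A) \<in> column_cone A"
        unfolding column_cone_def using x by (intro convex_cone_hull_mul) auto
      then show ?case using insert unfolding column_cone_def by (simp add: convex_cone_hull_add)
    qed
    from this[of UNIV] show "real_mat A *v x \<in> column_cone A"
      by (simp add: matrix_mult_sum scalar_mult_eq_scaleR)
  qed
qed

lemma matrix_mult_supported:
  fixes A :: "'a::comm_ring_1 ^ 'n ^ 'm"
  assumes "inj f" "\<And>k. k \<notin> range f \<Longrightarrow> z $ k = 0"
  shows "A *v z = column_submatrix A f *v (\<chi> i. z $ f i)"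
proof -
  have "(\<Sum>k\<in>UNIV. A $ i $ k * z $ k) = (\<Sum>j\<in>UNIV. A $ i $ f j * z $ f j)" for i
  proof -
    have "(\<Sum>k\<in>UNIV. A $ i $ k * z $ k) = (\<Sum>k\<in>range f. A $ i $ k * z $ k)"
      using assms(2) by (intro sum.mono_neutral_right) auto
    also have "\<dots> = (\<Sum>j\<in>UNIV. A $ i $ f j * z $ f j)"
      by (simp add: sum.reindex[OF assms(1)])
    finally show ?thesis .
  qed
  then show ?thesis by (simp add: vec_eq_iff matrix_vector_mult_def)
qed

lemma matrix_mult_extend:
  fixes A :: "'a::comm_ring_1 ^ 'n ^ 'm"
  assumes "inj f"
  shows "A *v (\<chi> k. if k \<in> range f then w $ inv f k else 0) = column_submatrix A f *v w"
  using assms by (subst matrix_mult_supported[OF assms]) (auto simp: vec_lambda_eta)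

lemma column_submatrix_real_mat: "column_submatrix (real_mat A) f = real_mat (column_submatrix A f)"
  by (simp add: vec_eq_iff)

text \<open>An invertible matrix maps the open positive orthant onto an open set, and this set lies
  in the cone.\<close>

lemma translated_simplicial_cone_interior:
  fixes A :: "int ^ 'n ^ 'm"
  assumes "inj f" "det (column_submatrix A f) \<noteq> 0" "\<And>i. 0 < \<theta> $ i"
  shows "v + real_mat (column_submatrix A f) *v \<theta> \<in> interior ((+) v ` column_cone A)"
proof -
  define T where "T = real_mat (column_submatrix A f)"
  define U where "U = {x :: real ^ 'm. \<forall>i. 0 < x $ i}"
  have "det T \<noteq> 0" using assms by (simp add: T_def det_real_mat)
  then have "\<exists>x. T *v x = b" for b using cramer[of T _ b] by blast
  then have "surj ((*v) T)" by (metis surj_def)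
  moreover have "U = (\<Inter>i. {x. 0 < x $ i})" by (auto simp: U_def)
  then have "open U" by (auto intro: open_INT open_halfspace_component_gt_cart)
  ultimately have "open ((*v) T ` U)"
    by (intro open_surjective_linear_image) auto
  then have "open ((+) v ` (*v) T ` U)" by (rule open_translation)
  moreover have "(*v) T ` U \<subseteq> column_cone A"
  proof clarify
    fix x assume x: "x \<in> U"
    define z where "z = (\<chi> k. if k \<in> range f then x $ inv f k else 0)"
    have "T *v x = real_mat A *v z"
      unfolding T_def z_def column_submatrix_real_mat[symmetric]
      by (rule matrix_mult_extend[OF assms(1), symmetric])
    moreover have "\<forall>k. 0 \<le> z $ k" using x by (auto simp: z_def U_def less_imp_le)
    ultimately show "T *v x \<in> column_cone A" by (auto simp: column_cone_eq)
  qed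
  ultimately have "(+) v ` (*v) T ` U \<subseteq> interior ((+) v ` column_cone A)"
    by (intro interior_maximal image_mono)
  then show ?thesis using assms(3) by (auto simp: T_def U_def)
qed

text \<open>Choosing exactly \<open>s\<close> solutions also covers the case of infinitely many and
  lets every residue class contribute the same number.\<close>

lemma s_feasible_real_vecE:
  assumes "real_vec b \<in> s_feasible s A"
  obtains F where "finite F" "card F = s" "\<And>x k. x \<in> F \<Longrightarrow> 0 \<le> x $ k" "\<And>x. x \<in> F \<Longrightarrow> A *v x = b"
proof -
  let ?S = "{x. (\<forall>k. 0 \<le> x $ k) \<and> A *v x = b}"
  have "solution_polyhedron A (real_vec b) \<inter> int_vecs = real_vec ` ?S"
    by (auto simp: solution_polyhedron_def real_mat_mult_real_vec elim!: int_vecsE)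
  moreover have "inj_on real_vec ?S" by (auto simp: inj_on_def)
  ultimately have "infinite ?S \<or> s \<le> card ?S"
    using assms by (auto simp: s_feasible_def card_image finite_image_iff)
  then obtain F where "F \<subseteq> ?S" "card F = s" "finite F"
    by (meson infinite_arbitrarily_large obtain_subset_with_card_n)
  then show ?thesis using that by blast
qed

lemma residue_class_representative:
  fixes A :: "int ^ 'n ^ 'm"
  assumes "inj f" "det (column_submatrix A f) \<noteq> 0"
  obtains b w \<theta> where "b = r + column_submatrix A f *v w"
    "real_vec b = v + real_mat (column_submatrix A f) *v \<theta>" "\<And>i. 0 < \<theta> $ i" "\<And>i. \<theta> $ i \<le> 1"
proof -
  define T where "T = column_submatrix A f"
  have "det (real_mat T) \<noteq> 0" using assms by (simp add: T_def det_real_mat)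
  then obtain \<rho> where \<rho>: "real_mat T *v \<rho> = real_vec r - v"
    using cramer[of "real_mat T" _ "real_vec r - v"] by blast
  \<comment> \<open>This moves each coordinate of \<open>\<theta>\<close> into the half-open
    interval from 0 (excluded) to 1 (included): positivity gives interior points, and the upper
    bound controls the facet functional.\<close>
  define w where "w = (\<chi> i. 1 - \<lceil>\<rho> $ i\<rceil>)"
  define \<theta> where "\<theta> = \<rho> + real_vec w"
  have "real_vec (r + T *v w) = real_vec r + real_mat T *v real_vec w"
    unfolding real_mat_mult_real_vec by (simp add: vec_eq_iff)
  also have "\<dots> = v + real_mat T *v \<theta>"
    by (simp add: \<theta>_def matrix_vector_right_distrib \<rho>)
  finally show ?thesis
  proof (rule that[OF refl, folded T_def])
    fix i
    show "0 < \<theta> $ i" "\<theta> $ i \<le> 1" unfolding \<theta>_def w_def by (simp_all, linarith+)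
  qed
qed

text \<open>The simplex involves only the weights on \<open>I\<close>. The missing factor
  \<open>c (f i0)\<close> of the product is the number of residue classes, and the missing summand
  of the sum is the excess of \<open>H\<close> over \<open>y \<bullet> v\<close>.\<close>

lemma frobenius_count_bound:
  fixes A :: "int ^ 'n ^ 'm" and f :: "'m \<Rightarrow> 'n" and i0 :: 'm and c :: "'n \<Rightarrow> real"
  defines "J \<equiv> f ` (- {i0})"
  assumes inj: "inj f"
    and y: "\<And>k. y \<bullet> column k (real_mat A) = (if k \<in> J then 0 else c k)"
    and c: "\<And>k. k \<notin> J \<Longrightarrow> 0 < c k"
    and det: "real_of_int \<bar>det (column_submatrix A f)\<bar> = c (f i0)"
    and t: "0 \<le> t"
    and valid: "interior ((+) (t *\<^sub>R diagonal_vector A) ` column_cone A) \<inter> int_vecs \<subseteq> s_feasible s A"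
  shows "real s * (fact (CARD('n) - CARD('m)) * (\<Prod>k\<in>-J. c k))
    \<le> ((t + 1) * (\<Sum>k\<in>-J. c k)) ^ (CARD('n) - CARD('m))"
proof -
  define T where "T = column_submatrix A f"
  define v where "v = t *\<^sub>R diagonal_vector A"
  define I where "I = - range f"
  \<comment> \<open>The first term is the value of \<open>y\<close> on \<open>v\<close>; the second
    bounds its value on \<open>real_mat T *v \<theta>\<close>, where only column \<open>f i0\<close>
    counts and \<open>\<theta> $ i0 \<le> 1\<close>.\<close>
  define H where "H = t * (\<Sum>k\<in>-J. c k) + c (f i0)"
  have i0: "f i0 \<notin> J" using inj by (auto simp: J_def inj_def)
  have JI: "- J = insert (f i0) I" and i0I: "f i0 \<notin> I"
    using inj by (auto simp: J_def I_def inj_def)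
  have cardI: "card I = CARD('n) - CARD('m)"
    unfolding I_def by (simp add: Compl_eq_Diff_UNIV card_Diff_subset card_image[OF inj])
  have detT: "det T \<noteq> 0" using det c[OF i0] by (auto simp: T_def)
  have cI: "0 < c k" if "k \<in> I" for k using that c JI by auto
  have "0 \<le> (\<Sum>k\<in>-J. c k)" using c by (intro sum_nonneg) (auto simp: less_imp_le)
  then have H0: "0 \<le> H" using t c[OF i0] by (simp add: H_def)
  obtain R where R: "finite R" "int (card R) = \<bar>det T\<bar>"
    and inc: "\<And>r r' w. \<lbrakk>r \<in> R; r' \<in> R; r - r' = T *v w\<rbrakk> \<Longrightarrow> r = r'"
    using incongruent_representatives[OF detT] by blast
  have yv: "y \<bullet> v = t * (\<Sum>k\<in>-J. c k)"
  proof -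
    have "y \<bullet> diagonal_vector A = (\<Sum>k\<in>UNIV. if k \<in> J then 0 else c k)"
      unfolding diagonal_vector_def matrix_vector_mult_columns by (simp add: y)
    also have "\<dots> = (\<Sum>k\<in>-J. c k)"
      by (rule sum.mono_neutral_cong_right) auto
    finally show ?thesis by (simp add: v_def)
  qed
  have "\<exists>b w F. b = r + T *v w \<and> y \<bullet> real_vec b \<le> H \<and> finite F \<and> card F = s \<and>
      (\<forall>x\<in>F. (\<forall>k. 0 \<le> x $ k) \<and> A *v x = b)" for r
  proof -
    obtain b w \<theta> where b: "b = r + T *v w" "real_vec b = v + real_mat T *v \<theta>"
      and \<theta>: "\<And>i. 0 < \<theta> $ i" "\<And>i. \<theta> $ i \<le> 1"
      using residue_class_representative[OF inj, of A r v] detT unfolding T_def by metis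
    have "y \<bullet> (real_mat T *v \<theta>) = (\<Sum>i\<in>UNIV. \<theta> $ i * (y \<bullet> column (f i) (real_mat A)))"
      unfolding matrix_vector_mult_columns by (simp add: T_def column_def)
    also have "\<dots> = (\<Sum>i\<in>{i0}. \<theta> $ i * (y \<bullet> column (f i) (real_mat A)))"
      by (intro sum.mono_neutral_right) (auto simp: y J_def)
    also have "\<dots> = \<theta> $ i0 * c (f i0)" using i0 by (simp add: y)
    also have "\<dots> \<le> c (f i0)" using \<theta>(2)[of i0] c[OF i0] by simp
    finally have "y \<bullet> real_vec b \<le> H" by (simp add: b(2) H_def inner_right_distrib yv)
    moreover have "real_vec b \<in> interior ((+) v ` column_cone A)"
      unfolding b(2) T_def
      by (rule translated_simplicial_cone_interior[OF inj _ \<theta>(1)]) (use detT in \<open>simp add: T_def\<close>)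
    then have "real_vec b \<in> s_feasible s A" using valid by (auto simp: v_def)
    then obtain F where "finite F" "card F = s" "\<And>x k. x \<in> F \<Longrightarrow> 0 \<le> x $ k" "\<And>x. x \<in> F \<Longrightarrow> A *v x = b"
      by (rule s_feasible_real_vecE) blast
    ultimately show ?thesis using b(1)
      by (intro exI[of _ b] exI[of _ w] exI[of _ F]) auto
  qed
  then have "\<forall>r. \<exists>b w F. b = r + T *v w \<and> y \<bullet> real_vec b \<le> H \<and> finite F \<and> card F = s \<and>
      (\<forall>x\<in>F. (\<forall>k. 0 \<le> x $ k) \<and> A *v x = b)" by blast
  then obtain b w F where b: "\<And>r. b r = r + T *v w r" and yb: "\<And>r. y \<bullet> real_vec (b r) \<le> H"
    and finF: "\<And>r. finite (F r)" and cardF: "\<And>r. card (F r) = s"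
    and F0: "\<And>r x k. x \<in> F r \<Longrightarrow> 0 \<le> x $ k" and FA: "\<And>r x. x \<in> F r \<Longrightarrow> A *v x = b r"
    by metis
  \<comment> \<open>If two solutions agree on \<open>I\<close>, their difference is supported on the
    columns of \<open>T\<close>. So their right-hand sides are congruent modulo \<open>T\<close>,
    which forces equal classes and, by injectivity of \<open>T\<close>, equal solutions.\<close>
  have same: "r = r' \<and> x = x'"
    if "r \<in> R" "r' \<in> R" "x \<in> F r" "x' \<in> F r'" "\<And>k. k \<in> I \<Longrightarrow> x $ k = x' $ k" for r r' x x'
  proof -
    define z where "z = (\<chi> i. (x - x') $ f i)"
    have "T *v z = A *v (x - x')"
      unfolding T_def z_def
      by (rule matrix_mult_supported[symmetric, OF inj]) (use that(5) in \<open>auto simp: I_def\<close>)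
    also have "\<dots> = b r - b r'"
      using FA that by (simp add: matrix_vector_mult_diff_distrib)
    finally have Tz: "T *v z = b r - b r'" .
    then have "r - r' = T *v (z - w r + w r')"
      by (simp add: b matrix_vector_mult_diff_distrib matrix_vector_right_distrib algebra_simps)
    then have "r = r'" using inc that by blast
    then have "T *v z = T *v 0" using Tz by simp
    then have "z = 0" using int_matrix_mult_inj[OF detT] by blast
    then have "x $ f i = x' $ f i" for i by (simp add: z_def vec_eq_iff)
    then have "x $ k = x' $ k" for k using that(5)[of k] by (auto simp: I_def)
    then show ?thesis using \<open>r = r'\<close> by (simp add: vec_eq_iff)
  qed
  define U where "U = (\<Union>r\<in>R. F r)"
  define \<Phi> :: "int ^ 'n \<Rightarrow> 'n \<Rightarrow> nat" where "\<Phi> x = restrict (\<lambda>k. nat (x $ k)) I" for x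
  define G where "G = {g \<in> I \<rightarrow>\<^sub>E (UNIV :: nat set). (\<Sum>i\<in>I. c i * real (g i)) \<le> H}"
  have G: "finite G" "real (card G) * (fact (card I) * (\<Prod>i\<in>I. c i)) \<le> (H + (\<Sum>i\<in>I. c i)) ^ card I"
    using card_nat_points_weighted_simplex[of I c H] cI H0 by (auto simp: G_def)
  have "card U = (\<Sum>r\<in>R. card (F r))"
    unfolding U_def by (rule card_UN_disjoint) (use R finF same in blast)+
  then have cardU: "card U = card R * s" by (simp add: cardF)
  have "inj_on \<Phi> U"
  proof (rule inj_onI)
    fix x x' assume "x \<in> U" "x' \<in> U" and eq: "\<Phi> x = \<Phi> x'"
    then obtain r r' where r: "r \<in> R" "r' \<in> R" "x \<in> F r" "x' \<in> F r'" by (auto simp: U_def)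
    have "x $ k = x' $ k" if "k \<in> I" for k
      using fun_cong[OF eq, of k] that F0[OF r(3), of k] F0[OF r(4), of k] by (simp add: \<Phi>_def)
    then show "x = x'" using same[OF r] by blast
  qed
  moreover have "\<Phi> ` U \<subseteq> G"
  proof clarify
    fix x assume "x \<in> U"
    then obtain r where r: "x \<in> F r" by (auto simp: U_def)
    have "(\<Sum>k\<in>I. c k * real (\<Phi> x k)) = (\<Sum>k\<in>I. real_of_int (x $ k) * (y \<bullet> column k (real_mat A)))"
      using F0[OF r] JI by (intro sum.cong) (auto simp: \<Phi>_def y)
    \<comment> \<open>The added terms are nonnegative because \<open>y\<close> is nonnegative on
      every column.\<close>
    also have "\<dots> \<le> (\<Sum>k\<in>UNIV. real_of_int (x $ k) * (y \<bullet> column k (real_mat A)))"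
      using F0[OF r] c by (intro sum_mono2) (auto simp: y less_imp_le)
    also have "\<dots> = y \<bullet> (real_mat A *v real_vec x)"
      by (simp add: matrix_vector_mult_columns)
    also have "\<dots> \<le> H" using yb[of r] FA[OF r] by (simp add: real_mat_mult_real_vec)
    finally show "\<Phi> x \<in> G" by (auto simp: G_def \<Phi>_def)
  qed
  ultimately have "card U \<le> card G" using G(1) by (metis card_image card_mono)
  then have le: "real (card R) * real s \<le> real (card G)"
    by (simp add: cardU flip: of_nat_mult)
  have "real (card R) = c (f i0)" using R(2) det by (metis T_def of_int_of_nat_eq)
  then have "real s * (fact (CARD('n) - CARD('m)) * (\<Prod>k\<in>-J. c k))
      = (real (card R) * real s) * (fact (card I) * (\<Prod>k\<in>I. c k))"
    using i0I by (simp add: JI cardI)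
  also have "\<dots> \<le> real (card G) * (fact (card I) * (\<Prod>k\<in>I. c k))"
    using cI by (intro mult_right_mono le mult_nonneg_nonneg prod_nonneg) (auto simp: less_imp_le)
  also have "\<dots> \<le> (H + (\<Sum>i\<in>I. c i)) ^ card I" by (rule G)
  also have "H + (\<Sum>i\<in>I. c i) = (t + 1) * (\<Sum>k\<in>-J. c k)"
    using i0I by (simp add: H_def JI algebra_simps)
  finally show ?thesis by (simp add: cardI)
qed

subsection \<open>The diagonal Frobenius number is attained\<close>

lemma Gcd_mem_ideal:
  fixes K :: "int set"
  assumes "finite S" "S \<subseteq> K" "0 \<in> K" "\<And>a b. \<lbrakk>a \<in> K; b \<in> K\<rbrakk> \<Longrightarrow> a + b \<in> K" "\<And>a c. a \<in> K \<Longrightarrow> c * a \<in> K"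
  shows "Gcd S \<in> K"
  using assms(1,2)
proof induction
  case empty
  then show ?case using assms(3) by simp
next
  case (insert a S)
  obtain u v where "u * a + v * Gcd S = gcd a (Gcd S)" using bezout_int by blast
  then show ?case using insert assms(4,5) by (metis Gcd_insert insert_subset)
qed

text \<open>The integers \<open>k\<close> for which every \<open>k *s b\<close> has an integral
  preimage form an ideal. By Cramer's rule it contains all maximal minors, hence their gcd.\<close>

lemma int_matrix_surj:
  fixes A :: "int ^ 'n ^ 'm"
  assumes "Gcd (maximal_minors A) = 1"
  shows "\<exists>z. A *v z = b"
proof -
  define K where "K = {k. \<forall>b. \<exists>z. A *v z = k *s b}"
  have "Gcd (maximal_minors A) \<in> K"
  proof (rule Gcd_mem_ideal)
    show "finite (maximal_minors A)" by (simp add: maximal_minors_alt)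
    show "maximal_minors A \<subseteq> K"
    proof
      fix k assume "k \<in> maximal_minors A"
      then obtain f where f: "inj f" "k = det (column_submatrix A f)" by (auto simp: maximal_minors_alt)
      have "\<exists>z. A *v z = k *s b" for b
        using cramer_int[of "column_submatrix A f" b] matrix_mult_extend[OF f(1), of A] f(2) by metis
      then show "k \<in> K" by (simp add: K_def)
    qed
    show "0 \<in> K" by (auto simp: K_def vec_eq_iff matrix_vector_mult_def intro!: exI[of _ 0])
    show "a + b \<in> K" if ab: "a \<in> K" "b \<in> K" for a b
      unfolding K_def
    proof (intro CollectI allI)
      fix c
      obtain z where "A *v z = a *s c" using ab(1) by (auto simp: K_def)
      moreover obtain z' where "A *v z' = b *s c" using ab(2) by (auto simp: K_def)
      ultimately have "A *v (z + z') = (a + b) *s c"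
        by (simp add: matrix_vector_right_distrib vec_eq_iff algebra_simps)
      then show "\<exists>z. A *v z = (a + b) *s c" by blast
    qed
    show "c * a \<in> K" if ac: "a \<in> K" for a c
      unfolding K_def
    proof (intro CollectI allI)
      fix b
      obtain z where "A *v z = a *s b" using ac by (auto simp: K_def)
      then have "A *v (c *s z) = (c * a) *s b"
        by (simp add: int_matrix_mult_scale vec_eq_iff mult_ac)
      then show "\<exists>z. A *v z = (c * a) *s b" by blast
    qed
  qed
  then have "\<exists>z. A *v z = 1 *s b" using assms by (simp add: K_def)
  moreover have "(1::int) *s b = b" by (simp add: vec_eq_iff)
  ultimately show ?thesis by simp
qed

text \<open>By Cramer's rule, \<open>det T\<close> times a column outside a nonsingular square
  submatrix \<open>T\<close> is an integral combination of the columns of \<open>T\<close>; this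
  relation is a kernel vector.\<close>

lemma int_kernel_nontrivial:
  fixes A :: "int ^ 'n ^ 'm"
  assumes "CARD('m) < CARD('n)" "Gcd (maximal_minors A) = 1"
  obtains u where "u \<noteq> 0" "A *v u = 0"
proof -
  have "\<not> maximal_minors A \<subseteq> {0}" using assms(2) by (metis Gcd_0_iff zero_neq_one)
  then obtain f where f: "inj f" "det (column_submatrix A f) \<noteq> 0" by (auto simp: maximal_minors_alt)
  define T where "T = column_submatrix A f"
  have "card (range f) < CARD('n)" using assms(1) by (simp add: card_image[OF f(1)])
  then obtain k where k: "k \<notin> range f" by (metis UNIV_eq_I less_irrefl)
  obtain w where w: "T *v w = det T *s column k A" using cramer_int by blast
  define z where "z = (\<chi> k. if k \<in> range f then w $ inv f k else 0)"
  have Az: "A *v z = det T *s column k A"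
    unfolding z_def using matrix_mult_extend[OF f(1), of A w] w by (simp add: T_def)
  have Ak: "A *v axis k 1 = column k A"
    by (simp add: vec_eq_iff matrix_vector_mult_def column_def axis_def if_distrib cong: if_cong)
  show ?thesis
  proof
    show "A *v (z - det T *s axis k 1) = 0"
      by (simp add: matrix_vector_mult_diff_distrib int_matrix_mult_scale Az Ak)
    have "(z - det T *s axis k 1) $ k = - det T" using k by (simp add: z_def axis_def)
    then show "z - det T *s axis k 1 \<noteq> 0" using f by (metis T_def neg_equal_0_iff_equal zero_index)
  qed
qed

text \<open>A point of the translated cone has a real solution with all coordinates at least
  \<open>t\<close>. Round it down, repair the bounded error with an integral right inverse
  \<open>Q\<close> of \<open>A\<close>, and add multiples of a kernel vector to obtain
  \<open>s\<close> distinct solutions.\<close>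

lemma feasible_threshold_exists:
  fixes A :: "int ^ 'n ^ 'm"
  assumes "CARD('m) < CARD('n)" "Gcd (maximal_minors A) = 1"
  shows "\<exists>t\<ge>0. interior ((+) (t *\<^sub>R diagonal_vector A) ` column_cone A) \<inter> int_vecs \<subseteq> s_feasible s A"
proof -
  obtain u where u: "u \<noteq> 0" "A *v u = 0" using int_kernel_nontrivial[OF assms] .
  have "\<forall>i. \<exists>z. A *v z = axis i 1" using int_matrix_surj[OF assms(2)] by blast
  then obtain q where q: "\<And>i. A *v q i = axis i 1" by metis
  define Q where "Q = (\<chi> k i. q i $ k)"
  have "A ** Q = mat 1"
  proof -
    have "(A ** Q) $ i $ k = (A *v q k) $ i" for i k
      by (simp add: matrix_matrix_mult_def matrix_vector_mult_def Q_def)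
    then show ?thesis by (simp add: q vec_eq_iff mat_def axis_def)
  qed
  then have AQ: "A *v (Q *v e) = e" for e
    by (simp add: matrix_vector_mul_assoc)
  \<comment> \<open>\<open>B\<close> bounds the entries of the rounding error, \<open>r\<close>
    those of its correction by \<open>Q\<close>, and \<open>int s * N\<close> those of the kernel
    shifts; \<open>t\<close> absorbs the last two.\<close>
  define B where "B = (\<Sum>i\<in>UNIV. \<Sum>k\<in>UNIV. \<bar>A $ i $ k\<bar>)"
  define r where "r = (\<Sum>k\<in>UNIV. \<Sum>i\<in>UNIV. \<bar>Q $ k $ i\<bar>) * B"
  define N where "N = (\<Sum>k\<in>UNIV. \<bar>u $ k\<bar>)"
  define t where "t = r + int s * N"
  have t0: "0 \<le> t" unfolding t_def r_def N_def B_def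
    by (intro add_nonneg_nonneg mult_nonneg_nonneg sum_nonneg) auto
  have "b \<in> s_feasible s A"
    if b: "b \<in> interior ((+) (real_of_int t *\<^sub>R diagonal_vector A) ` column_cone A)" "b \<in> int_vecs" for b
  proof -
    obtain z where z: "b = real_vec z" using b(2) by (rule int_vecsE)
    have "b \<in> (+) (real_of_int t *\<^sub>R diagonal_vector A) ` column_cone A"
      using b(1) interior_subset by blast
    then obtain x where x: "\<And>k. 0 \<le> x $ k"
      and bx: "b = real_of_int t *\<^sub>R diagonal_vector A + real_mat A *v x"
      by (auto simp: column_cone_eq)
    define x0 where "x0 = real_of_int t *\<^sub>R 1 + x"
    have bx0: "b = real_mat A *v x0"
      by (simp add: bx x0_def diagonal_vector_def matrix_vector_right_distrib matrix_vector_mult_scaleR)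
    define w where "w = (\<chi> k. \<lfloor>x0 $ k\<rfloor>)"
    have w: "t \<le> w $ k" for k using x[of k] by (simp add: w_def x0_def le_floor_iff)
    \<comment> \<open>The error is the image under \<open>A\<close> of the fractional parts of
      \<open>x0\<close>.\<close>
    define e where "e = z - A *v w"
    have e_eq: "real_vec e = real_mat A *v (x0 - real_vec w)"
    proof -
      have "real_vec e = real_vec z - real_vec (A *v w)" by (simp add: e_def vec_eq_iff)
      then show ?thesis
        by (simp add: matrix_vector_mult_diff_distrib bx0[symmetric] z real_mat_mult_real_vec)
    qed
    have eB: "\<bar>e $ i\<bar> \<le> B" for i
    proof -
      have frac: "\<bar>(x0 - real_vec w) $ k\<bar> \<le> 1" for k by (simp add: w_def) linarith
      have "real_of_int (e $ i) = (\<Sum>k\<in>UNIV. real_of_int (A $ i $ k) * (x0 - real_vec w) $ k)"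
        using arg_cong[OF e_eq, of "\<lambda>v. v $ i"] by (simp add: matrix_vector_mult_def)
      then have "\<bar>real_of_int (e $ i)\<bar> \<le> (\<Sum>k\<in>UNIV. \<bar>real_of_int (A $ i $ k) * (x0 - real_vec w) $ k\<bar>)"
        by (metis sum_abs)
      also have "\<dots> \<le> (\<Sum>k\<in>UNIV. \<bar>real_of_int (A $ i $ k)\<bar>)"
        unfolding abs_mult using frac by (intro sum_mono mult_left_le) auto
      also have "\<dots> = real_of_int (\<Sum>k\<in>UNIV. \<bar>A $ i $ k\<bar>)" by simp
      finally have "\<bar>e $ i\<bar> \<le> (\<Sum>k\<in>UNIV. \<bar>A $ i $ k\<bar>)" by linarith
      also have "\<dots> \<le> B" unfolding B_def
        by (rule member_le_sum) (auto intro: sum_nonneg)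
      finally show ?thesis .
    qed
    have Qe: "- r \<le> (Q *v e) $ k" for k
    proof -
      have "0 \<le> B" unfolding B_def by (intro sum_nonneg) auto
      have "\<bar>(Q *v e) $ k\<bar> \<le> (\<Sum>i\<in>UNIV. \<bar>Q $ k $ i * e $ i\<bar>)"
        unfolding matrix_vector_mult_def by simp
      also have "\<dots> \<le> (\<Sum>i\<in>UNIV. \<bar>Q $ k $ i\<bar> * B)"
        unfolding abs_mult using eB by (intro sum_mono mult_left_mono) auto
      also have "\<dots> = (\<Sum>i\<in>UNIV. \<bar>Q $ k $ i\<bar>) * B" by (simp add: sum_distrib_right)
      also have "\<dots> \<le> r" unfolding r_def
        using \<open>0 \<le> B\<close> by (intro mult_right_mono member_le_sum) (auto intro: sum_nonneg)
      finally show ?thesis by linarith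
    qed
    define sol where "sol i = w + Q *v e + int i *s u" for i :: nat
    have A_sol: "A *v sol i = z" for i
      by (simp add: sol_def matrix_vector_right_distrib int_matrix_mult_scale AQ u e_def)
    have nonneg: "0 \<le> sol i $ k" if "i < s" for i k
    proof -
      have "\<bar>u $ k\<bar> \<le> N" unfolding N_def by (rule member_le_sum) auto
      then have "int i * \<bar>u $ k\<bar> \<le> int s * N" using that by (intro mult_mono) auto
      moreover have "- (int i * \<bar>u $ k\<bar>) \<le> int i * u $ k"
        by (metis abs_ge_minus_self abs_mult abs_of_nat minus_le_iff)
      ultimately show ?thesis using w[of k] Qe[of k] by (simp add: sol_def t_def)
    qed
    have "inj sol"
    proof (rule injI)
      fix i j assume eq: "sol i = sol j"
      obtain k where "u $ k \<noteq> 0" using u(1) by (auto simp: vec_eq_iff)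
      moreover have "int i * u $ k = int j * u $ k"
        using arg_cong[OF eq, of "\<lambda>v. v $ k"] by (simp add: sol_def)
      ultimately show "i = j" by simp
    qed
    define S where "S = solution_polyhedron A b \<inter> int_vecs"
    have "(\<lambda>i. real_vec (sol i)) ` {..<s} \<subseteq> S"
      using nonneg by (auto simp: S_def solution_polyhedron_def real_mat_mult_real_vec A_sol z)
    moreover have "card ((\<lambda>i. real_vec (sol i)) ` {..<s}) = s"
      using \<open>inj sol\<close> by (subst card_image) (auto simp: inj_on_def)
    ultimately have "infinite S \<or> s \<le> card S" using card_mono by metis
    then show ?thesis using b(2) by (simp add: s_feasible_def S_def)
  qed
  then show ?thesis using t0 by (intro exI[of _ "real_of_int t"]) auto
qed

text \<open>The infimum is attained because \<open>int (t v + C)\<close> varies openly with \<open>t\<close>.\<close>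

lemma diagonal_frobenius_valid:
  fixes A :: "int ^ 'n ^ 'm"
  assumes "CARD('m) < CARD('n)" "Gcd (maximal_minors A) = 1"
  shows "0 \<le> diagonal_frobenius s A"
    and "interior ((+) (diagonal_frobenius s A *\<^sub>R diagonal_vector A) ` column_cone A) \<inter> int_vecs
      \<subseteq> s_feasible s A"
proof -
  define v where "v = diagonal_vector A"
  define P where "P t \<longleftrightarrow> 0 \<le> t \<and> interior ((+) (t *\<^sub>R v) ` column_cone A) \<inter> int_vecs \<subseteq> s_feasible s A" for t
  define t0 where "t0 = Inf {t. P t}"
  have ne: "{t. P t} \<noteq> {}" using feasible_threshold_exists[OF assms] by (auto simp: P_def v_def)
  have bdd: "bdd_below {t. P t}" by (rule bdd_belowI[of _ 0]) (simp add: P_def)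
  have lower: "t0 \<le> t" if "P t" for t unfolding t0_def using that bdd by (intro cInf_lower) auto
  have mem: "b \<in> interior ((+) (t *\<^sub>R v) ` column_cone A) \<longleftrightarrow> b - t *\<^sub>R v \<in> interior (column_cone A)" for b t
    unfolding interior_translation by (auto simp: image_iff intro!: bexI[of _ "b - t *\<^sub>R v"])
  have "P t0"
    unfolding P_def
  proof (intro conjI subsetI)
    show "0 \<le> t0" unfolding t0_def using ne by (intro cInf_greatest) (auto simp: P_def)
    fix b assume b: "b \<in> interior ((+) (t0 *\<^sub>R v) ` column_cone A) \<inter> int_vecs"
    then obtain \<epsilon> where \<epsilon>: "0 < \<epsilon>" "ball (b - t0 *\<^sub>R v) \<epsilon> \<subseteq> interior (column_cone A)"
      using mem open_contains_ball[of "interior (column_cone A)"] by auto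
    have pos: "0 < norm v + 1" by (simp add: add_nonneg_pos)
    \<comment> \<open>Choose an admissible \<open>t\<close> so close to the infimum that
      \<open>b - t *\<^sub>R v\<close> stays in the ball; the added 1 covers
      \<open>v = 0\<close>.\<close>
    have "Inf {t. P t} < t0 + \<epsilon> / (norm v + 1)" using \<epsilon> pos by (simp add: t0_def)
    then obtain t where t: "P t" "t < t0 + \<epsilon> / (norm v + 1)" using cInf_lessD[OF ne] by auto
    have "dist (b - t0 *\<^sub>R v) (b - t *\<^sub>R v) = (t - t0) * norm v"
      using lower[OF t(1)] by (simp add: dist_norm flip: scaleR_diff_left)
    also have "\<dots> \<le> (t - t0) * (norm v + 1)"
      using lower[OF t(1)] by (intro mult_left_mono) auto
    also have "\<dots> < \<epsilon>" using t(2) pos by (simp add: field_simps)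
    finally have "b - t *\<^sub>R v \<in> interior (column_cone A)" using \<epsilon>(2) by (auto simp: subset_iff)
    then show "b \<in> s_feasible s A" using t(1) b mem by (auto simp: P_def)
  qed
  \<comment> \<open>As the infimum is itself admissible, it is the value selected by
    \<open>LEAST\<close>.\<close>
  then have "diagonal_frobenius s A = t0"
    unfolding diagonal_frobenius_def v_def[symmetric] P_def[symmetric] by (rule Least_equality) (rule lower)
  with \<open>P t0\<close> show "0 \<le> diagonal_frobenius s A"
    and "interior ((+) (diagonal_frobenius s A *\<^sub>R diagonal_vector A) ` column_cone A) \<inter> int_vecs
      \<subseteq> s_feasible s A"
    by (auto simp: P_def v_def)
qed

subsection \<open>The lower bound\<close>

text \<open>Pair the factors of the two factorials in opposite order:
  \<open>(i + 1) * (d - i) \<ge> d\<close> for \<open>i < d\<close>.\<close>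

lemma power_self_le_fact_squared: "d ^ d \<le> (fact d :: nat)\<^sup>2"
proof -
  have "d ^ d = (\<Prod>i = 0..<d. d)" by simp
  also have "\<dots> \<le> (\<Prod>i = 0..<d. Suc i * (d - i))"
  proof (rule prod_mono)
    fix i assume "i \<in> {0..<d}"
    then obtain k where "d = Suc (i + k)" using less_imp_Suc_add by auto
    then show "0 \<le> d \<and> d \<le> Suc i * (d - i)" by simp
  qed
  also have "\<dots> = (fact d)\<^sup>2"
    unfolding prod.distrib power2_eq_square by (metis fact_prod_Suc fact_prod_rev of_nat_id)
  finally show ?thesis .
qed

lemma powr_inverse_power:
  fixes x :: real
  assumes "0 \<le> x" "1 \<le> d"
  shows "(x powr (1 / real d)) ^ d = x"
  using assms by (cases "x = 0") (simp_all add: powr_realpow[symmetric] powr_powr)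

text \<open>With \<open>W = (t + 1) * (d + 1)\<close>, the Gram and counting bounds together give
  \<open>X ^ d \<le> (\<rho> * W) ^ d\<close>. Taking roots leaves a linear estimate in
  \<open>t\<close>.\<close>

lemma root_volume_bound:
  fixes s d n :: nat and t M \<mu> G :: real
  assumes d: "1 \<le> d" and n: "1 \<le> n" and \<mu>: "0 < \<mu>" "\<mu> \<le> M" and t: "0 \<le> t" and G: "0 \<le> G"
    and gram: "fact d * G \<le> real n ^ d * M\<^sup>2"
    and count: "real s * fact d * M * (\<mu> / M) ^ d \<le> ((t + 1) * (real d + 1)) ^ d"
  shows "1 / (real d + 1) * (real s powr (1 / real d) * sqrt G powr (1 / real d) * (\<mu> / M)\<^sup>2
      * sqrt (real d / real n) - real d - 2 * (\<mu> / M)) \<le> t"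
proof -
  define \<rho> where "\<rho> = \<mu> / M"
  define W where "W = (t + 1) * (real d + 1)"
  define X where "X = real s powr (1 / real d) * sqrt G powr (1 / real d) * \<rho>\<^sup>2 * sqrt (real d / real n)"
  have M: "0 < M" using \<mu> by linarith
  have \<rho>: "0 < \<rho>" "\<rho> \<le> 1" using \<mu> M by (simp_all add: \<rho>_def)
  have W: "2 \<le> W" unfolding W_def using t d mult_mono[of 1 "t + 1" 2 "real d + 1"] by simp
  have "real d ^ d \<le> (fact d)\<^sup>2"
    using power_self_le_fact_squared[of d] by (metis of_nat_fact of_nat_le_iff of_nat_power)
  \<comment> \<open>The third factorial cancels the one on the left of \<open>gram\<close>.\<close>
  also have "\<dots> \<le> (fact d) ^ 3" by (rule power_increasing) (auto simp: fact_ge_1)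
  finally have dd: "real d ^ d \<le> fact d ^ 3" .
  have "G * real d ^ d \<le> (fact d * M)\<^sup>2 * real n ^ d"
  proof -
    have "fact d * (G * real d ^ d) \<le> (real n ^ d * M\<^sup>2) * real d ^ d"
      using mult_right_mono[OF gram, of "real d ^ d"] by (simp add: mult.assoc)
    also have "\<dots> \<le> (real n ^ d * M\<^sup>2) * fact d ^ 3"
      using dd by (intro mult_left_mono) auto
    also have "\<dots> = fact d * ((fact d * M)\<^sup>2 * real n ^ d)"
      by (simp add: power2_eq_square power3_eq_cube)
    finally show ?thesis by (simp add: fact_gt_zero)
  qed
  then have "G * (real d / real n) ^ d \<le> (fact d * M)\<^sup>2"
    using n by (simp add: power_divide field_simps)
  then have "sqrt (G * (real d / real n) ^ d) \<le> fact d * M"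
    using M by (intro real_le_lsqrt) auto
  then have sq: "sqrt G * sqrt (real d / real n) ^ d \<le> fact d * M"
    by (simp add: real_sqrt_mult real_sqrt_power)
  have "X ^ d = real s * sqrt G * (\<rho>\<^sup>2) ^ d * sqrt (real d / real n) ^ d"
    unfolding X_def power_mult_distrib using d G by (simp add: powr_inverse_power)
  also have "\<dots> = (real s * \<rho> ^ d * \<rho> ^ d) * (sqrt G * sqrt (real d / real n) ^ d)"
    by (simp add: power2_eq_square power_mult_distrib)
  also have "\<dots> \<le> (real s * \<rho> ^ d * \<rho> ^ d) * (fact d * M)"
    using sq \<rho> by (intro mult_left_mono) auto
  also have "\<dots> = \<rho> ^ d * (real s * fact d * M * \<rho> ^ d)" by simp
  also have "\<dots> \<le> \<rho> ^ d * W ^ d"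
    using count \<rho> by (intro mult_left_mono) (auto simp: \<rho>_def W_def)
  finally have "X ^ d \<le> (\<rho> * W) ^ d" by (simp add: power_mult_distrib)
  then have "X \<le> \<rho> * W"
    using \<rho> W d by (intro power_le_imp_le_base[of X "d - 1" "\<rho> * W"]) auto
  \<comment> \<open>This replaces \<open>\<rho> * W - 2 * \<rho>\<close> by \<open>W - 2\<close>,
    removing the ratio from the bound.\<close>
  moreover have "0 \<le> (1 - \<rho>) * (W - 2)" using \<rho> W by (intro mult_nonneg_nonneg) auto
  ultimately have "X - real d - 2 * \<rho> \<le> W - (real d + 1)" by (simp add: algebra_simps)
  also have "\<dots> = t * (real d + 1)" by (simp add: W_def algebra_simps)
  finally show ?thesis by (simp add: X_def \<rho>_def field_simps)
qed

text \<open>Compare with the largest weight \<open>C\<close>: the product is at least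
  \<open>C * \<mu> ^ d\<close> and the sum at most \<open>(d + 1) * C\<close>. Cancelling one
  \<open>C\<close> leaves \<open>C ^ (d - 1)\<close> on the right, which may be enlarged to
  \<open>M ^ (d - 1)\<close>.\<close>

lemma weights_count_bound:
  fixes c :: "'a \<Rightarrow> real" and t M \<mu> :: real
  assumes "card K = Suc d" "1 \<le> d" and c: "\<And>k. k \<in> K \<Longrightarrow> \<mu> \<le> c k" "\<And>k. k \<in> K \<Longrightarrow> c k \<le> M"
    and \<mu>: "0 < \<mu>" and t: "0 \<le> t"
    and count: "real s * (fact d * (\<Prod>k\<in>K. c k)) \<le> ((t + 1) * (\<Sum>k\<in>K. c k)) ^ d"
  shows "real s * fact d * M * (\<mu> / M) ^ d \<le> ((t + 1) * (real d + 1)) ^ d"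
proof -
  have fin: "finite K" and ne: "K \<noteq> {}" using assms(1) card.infinite by fastforce+
  obtain k1 where k1: "k1 \<in> K" and max: "\<And>k. k \<in> K \<Longrightarrow> c k \<le> c k1"
  proof -
    have "Max (c ` K) \<in> c ` K" using fin ne by (intro Max_in) auto
    then obtain k1 where "k1 \<in> K" "Max (c ` K) = c k1" by auto
    then show ?thesis using that[of k1] fin by (metis Max_ge finite_imageI imageI)
  qed
  define C where "C = c k1"
  have C: "0 < C" "C \<le> M" using c k1 \<mu> by (auto simp: C_def intro: less_le_trans)
  obtain e where e: "d = Suc e" using assms(2) by (cases d) auto
  have "\<mu> ^ d = (\<Prod>k\<in>K - {k1}. \<mu>)" using assms(1) k1 fin by simp
  also have "\<dots> \<le> (\<Prod>k\<in>K - {k1}. c k)" using c \<mu> by (intro prod_mono) auto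
  finally have "C * \<mu> ^ d \<le> C * (\<Prod>k\<in>K - {k1}. c k)" using C by simp
  also have "\<dots> = (\<Prod>k\<in>K. c k)" using fin k1 by (simp add: C_def prod.remove)
  finally have prod: "C * \<mu> ^ d \<le> (\<Prod>k\<in>K. c k)" .
  have "(\<Sum>k\<in>K. c k) \<le> (\<Sum>k\<in>K. C)" using max by (intro sum_mono) (auto simp: C_def)
  then have sum: "(\<Sum>k\<in>K. c k) \<le> (real d + 1) * C" using assms(1) by (simp add: algebra_simps)
  have sum0: "0 \<le> (\<Sum>k\<in>K. c k)" using c \<mu> by (intro sum_nonneg) force
  have "real s * fact d * (C * \<mu> ^ d) \<le> real s * fact d * (\<Prod>k\<in>K. c k)"
    using prod by (intro mult_left_mono) auto
  also have "\<dots> \<le> ((t + 1) * (\<Sum>k\<in>K. c k)) ^ d" using count by (simp add: mult.assoc)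
  also have "\<dots> \<le> ((t + 1) * ((real d + 1) * C)) ^ d"
    using sum sum0 t by (intro power_mono mult_left_mono) auto
  also have "\<dots> = C * (((t + 1) * (real d + 1)) ^ d * C ^ e)"
    by (simp add: e power_mult_distrib)
  finally have "real s * fact d * \<mu> ^ d \<le> ((t + 1) * (real d + 1)) ^ d * C ^ e"
    using C by (simp add: mult_ac)
  also have "\<dots> \<le> ((t + 1) * (real d + 1)) ^ d * M ^ e"
    using C t by (intro mult_left_mono power_mono) auto
  finally have "real s * fact d * \<mu> ^ d / M ^ e \<le> ((t + 1) * (real d + 1)) ^ d"
    using C by (simp add: pos_divide_le_eq)
  moreover have "real s * fact d * M * (\<mu> / M) ^ d = real s * fact d * \<mu> ^ d / M ^ e"
    using C by (simp add: e power_divide)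
  ultimately show ?thesis by simp
qed

theorem theorem1p3:
  fixes A :: "int ^ 'n ^ 'm" and s :: nat
  assumes "CARD('m) < CARD('n)"
    and "1 \<le> s"
    and "Gcd (maximal_minors A) = 1"
    and "solution_polyhedron A 0 = {0}"
  shows "diagonal_frobenius s A \<ge>
    1 / (real CARD('n) - real CARD('m) + 1) *
    (real s powr (1 / (real CARD('n) - real CARD('m))) *
       sqrt (real_of_int (det (A ** transpose A))) powr (1 / (real CARD('n) - real CARD('m))) *
       (real_of_int (min_abs_minor A) / real_of_int (max_abs_minor A))\<^sup>2 *
       sqrt ((real CARD('n) - real CARD('m)) / real CARD('n))
     - (real CARD('n) - real CARD('m))
     - 2 * (real_of_int (min_abs_minor A) / real_of_int (max_abs_minor A)))"
proof -
  define d where "d = CARD('n) - CARD('m)"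
  define M where "M = max_abs_minor A"
  define \<mu> where "\<mu> = min_abs_minor A"
  define t where "t = diagonal_frobenius s A"
  have d: "1 \<le> d" "real CARD('n) - real CARD('m) = real d" using assms(1) by (auto simp: d_def)
  have t: "0 \<le> t"
    and valid: "interior ((+) (t *\<^sub>R diagonal_vector A) ` column_cone A) \<inter> int_vecs \<subseteq> s_feasible s A"
    unfolding t_def using diagonal_frobenius_valid[OF assms(1,3)] by blast+
  have minors: "\<mu> \<le> \<bar>det (column_submatrix A f)\<bar>" "\<bar>det (column_submatrix A f)\<bar> \<le> M" if "inj f" for f
    using that by (auto simp: \<mu>_def M_def min_abs_minor_def max_abs_minor_def maximal_minors_alt)
  have "card {f :: 'm \<Rightarrow> 'n. inj f} > 0"
    using assms(1) by (simp add: card_inj_functions)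
  then obtain f0 :: "'m \<Rightarrow> 'n" where f0: "inj f0" by (metis card.empty empty_Collect_eq less_irrefl)
  have "\<mu> \<in> abs ` maximal_minors A"
    unfolding \<mu>_def min_abs_minor_def using f0 by (intro Min_in) (auto simp: maximal_minors_alt)
  then have "0 \<le> \<mu>" by auto
  have "1 / (real d + 1) * (real s powr (1 / real d) * sqrt (real_of_int (det (A ** transpose A))) powr (1 / real d) *
       (real_of_int \<mu> / real_of_int M)\<^sup>2 * sqrt (real d / real CARD('n)) - real d
       - 2 * (real_of_int \<mu> / real_of_int M)) \<le> t"
  proof (cases "\<mu> = 0")
    case True
    \<comment> \<open>The ratio of the minors is zero, so the claimed bound is
      \<open>- d / (d + 1)\<close>.\<close>
    then show ?thesis using t by (simp add: field_simps) (smt (verit) mult_nonneg_nonneg of_nat_0_le_iff)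
  next
    case False
    with \<open>0 \<le> \<mu>\<close> have \<mu>: "0 < \<mu>" by simp
    have "det (column_submatrix A f) \<noteq> 0" if "inj f" for f using minors(1)[OF that] \<mu> by auto
    then obtain f i0 y where f: "inj f"
      and y: "\<And>k. y \<bullet> column k (real_mat A) =
        (if k \<in> f ` (- {i0}) then 0 else real_of_int \<bar>det (column_submatrix A (f(i0 := k)))\<bar>)"
      using facet_minors[OF assms(1) _ assms(4)] by metis
    define J where "J = f ` (- {i0})"
    define c where "c k = real_of_int \<bar>det (column_submatrix A (f(i0 := k)))\<bar>" for k
    \<comment> \<open>Hence each weight off the facet comes from a maximal minor and lies between
      \<open>\<mu>\<close> and \<open>M\<close>.\<close>
    have "inj (f(i0 := k))" if "k \<notin> J" for k
      using f that by (auto simp: inj_def J_def)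
    then have c: "real_of_int \<mu> \<le> c k" "c k \<le> real_of_int M" if "k \<notin> J" for k
      unfolding c_def using minors that by (metis of_int_le_iff)+
    have "card (f ` (- {i0})) = CARD('m) - 1"
      using f by (subst card_image) (auto simp: Compl_eq_Diff_UNIV inj_def inj_on_def card_Diff_subset)
    then have cardJ: "card (- J) = Suc d"
      using assms(1) by (simp add: J_def d_def Compl_eq_Diff_UNIV card_Diff_subset Suc_diff_le)
    have "real s * (fact d * (\<Prod>k\<in>-J. c k)) \<le> ((t + 1) * (\<Sum>k\<in>-J. c k)) ^ d"
      unfolding d_def J_def
    proof (rule frobenius_count_bound[OF f])
      show "y \<bullet> column k (real_mat A) = (if k \<in> f ` (- {i0}) then 0 else c k)" for k
        by (simp add: y c_def)
      show "0 < c k" if "k \<notin> f ` (- {i0})" for k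
        using c(1)[of k] that \<mu> by (simp add: J_def)
      show "real_of_int \<bar>det (column_submatrix A f)\<bar> = c (f i0)" by (simp add: c_def)
    qed (use t valid in auto)
    then have count: "real s * fact d * real_of_int M * (real_of_int \<mu> / real_of_int M) ^ d
        \<le> ((t + 1) * (real d + 1)) ^ d"
      using c \<mu> by (intro weights_count_bound[OF cardJ d(1) _ _ _ t]) auto
    have "fact d * det (A ** transpose A) \<le> int CARD('n) ^ d * M\<^sup>2"
      unfolding d_def using assms(1) minors(2) by (intro det_gram_le) auto
    then have "real_of_int (fact d * det (A ** transpose A)) \<le> real_of_int (int CARD('n) ^ d * M\<^sup>2)"
      by (simp only: of_int_le_iff)
    then have gram: "fact d * real_of_int (det (A ** transpose A)) \<le> real CARD('n) ^ d * (real_of_int M)\<^sup>2"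
      by simp
    \<comment> \<open>Cauchy-Binet exhibits the Gram determinant as a sum of squares up to a
      positive factor.\<close>
    have "0 \<le> int (fact CARD('m)) * det (A ** transpose A)"
      using cauchy_binet_gram[of A] by (simp add: sum_nonneg)
    then have "0 \<le> det (A ** transpose A)"
      by (metis fact_gt_zero of_nat_0_less_iff zero_le_mult_iff not_le)
    then show ?thesis
      using \<mu> minors[OF f0] d t gram count by (intro root_volume_bound) auto
  qed
  then show ?thesis by (simp only: d(2) t_def \<mu>_def M_def)
qed

end
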